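(* Let $d\ge 1$ be an integer and let $p(\cdot)\in\mathcal{P}_{\gamma_{d}}^{\infty}(\mathbb{R}^{d})\cap LH_{0}(\mathbb{R}^{d})$ with $1<p_{-}\leq p_{+}<\infty$. Then for every $\beta\geq 1$ there exists a constant $C>0$, depending only on $p(\cdot)$, $\beta$ and the dimension $d$, such that $$\| I_\beta f\|_{p(\cdot),\gamma_{d}} \leq C\, \| f\|_{p(\cdot),\gamma_{d}}$$ for every $f \in L^{p(\cdot)}(\mathbb{R}^d,\gamma_d)$, where $I_\beta$ is the Gaussian Riesz potential of order $\beta$.
   Context: **Gaussian measure.** $\gamma_d$ is the Gaussian probability measure on $\mathbb{R}^d$, $\gamma_d(dx)=\pi^{-d/2}e^{-|x|^2}\,dx$. **Exponent functions.** An exponent function is a measurable function $p(\cdot):\mathbb{R}^d\to[1,\infty]$. Set $p_-=\operatorname{ess\,inf}_{x\in\mathbb{R}^d}p(x)$ and $p_+=\operatorname{ess\,sup}_{x\in\mathbb{R}^d}p(x)$. - $p(\cdot)\in LH_0(\mathbb{R}^d)$ (locally log-Hölder continuous) means that $p(\cdot)$ is real-valued and there is a constant $C_1>0$ such that $|p(x)-p(y)|\le \dfrac{C_1}{\log\left(e+\frac{1}{|x-y|}\right)}$ for all $x,y\in\mathbb{R}^d$ with $x\neq y$. - $p(\cdot)\in\mathcal{P}_{\gamma_d}^\infty(\mathbb{R}^d)$ means that $p(\cdot)$ is an exponent function and there exist constants $C_{\gamma_d}>0$ and $p_\infty\ge 1$ such that $|p(x)-p_\infty|\le \dfrac{C_{\gamma_d}}{|x|^2}$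 for all $x\in\mathbb{R}^d\setminus\{0\}$. **Gaussian variable Lebesgue space.** For an exponent function with $p_+<\infty$ and a measurable $f:\mathbb{R}^d\to\overline{\mathbb{R}}$, define the modular $\rho_{p(\cdot),\gamma_d}(f)=\int_{\mathbb{R}^d}|f(x)|^{p(x)}\,\gamma_d(dx)$. The space $L^{p(\cdot)}(\gamma_d)=L^{p(\cdot)}(\mathbb{R}^d,\gamma_d)$ consists of the measurable $f$ with $\rho_{p(\cdot),\gamma_d}(f/\lambda)<\infty$ for some $\lambda>0$, and it is normed by $\|f\|_{p(\cdot),\gamma_d}=\inf\{\lambda>0:\rho_{p(\cdot),\gamma_d}(f/\lambda)\le 1\}$. **Gaussian Riesz potential.** For $\beta>0$, $I_\beta=(-L)^{-\beta/2}\Pi_0$, where $L=\frac12\Delta-\langle x,\nabla_x\rangle$ is the Ornstein–Uhlenbeck operator and $\Pi_0 f=f-\int_{\mathbb{R}^d}f\,d\gamma_d$. This means that on the Hermite polynomials $\vec H_\nu$ (orthogonal with respect to $\gamma_d$, $\nu$ a multi-index) one has $I_\beta\vec H_\nu=|\nu|^{-\beta/2}\vec H_\nu$ if $|\nu|>0$, and $I_\beta\vec H_0=0$. On $L^{p(\cdot)}(\gamma_d)$ the operator is understood through its integral representation $$I_\beta f(x)=\int_{\mathbb{R}^d}N_{\beta/2}(x,y)\,f(y)\,dy,$$ $$N_{\beta/2}(x,y)=\frac{1}{\pi^{d/2}\,\Gamma(\beta/2)}\int_0^{\infty}t^{\frac{\beta}{2}-1}\left(\frac{e^{-\frac{|y-e^{-t}x|^2}{1-e^{-2t}}}}{(1-e^{-2t})^{d/2}}-e^{-|y|^2}\right)dt\qquad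 (x\ne y).$$ *)

theory Defs
  imports "HOL-Analysis.Analysis" "HOL-Probability.Essential_Supremum"
begin

definition gaussian_measure :: "(real ^ 'n::finite) measure"  (\<open>\<gamma>\<close>)
  where "gaussian_measure =
    density lebesgue (\<lambda>x. ennreal (pi powr (- (real CARD('n) / 2)) * exp (- (norm x)\<^sup>2)))"


section \<open>Exponent functions\<close>

text \<open>Measurability is Lebesgue measurability throughout.\<close>

definition exponent_function :: "(real ^ 'n::finite \<Rightarrow> ereal) \<Rightarrow> bool"
  where "exponent_function p \<longleftrightarrow> p \<in> borel_measurable lebesgue \<and> (\<forall>x. 1 \<le> p x)"

definition p_plus :: "(real ^ 'n::finite \<Rightarrow> ereal) \<Rightarrow> ereal"
  where "p_plus p = esssup lebesgue p"

definition p_minus :: "(real ^ 'n::finite \<Rightarrow> ereal) \<Rightarrow> ereal"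
  where "p_minus p = - esssup lebesgue (\<lambda>x. - p x)"

definition LH0 :: "(real ^ 'n::finite \<Rightarrow> ereal) set"
  where "LH0 = {p. (\<forall>x. \<bar>p x\<bar> \<noteq> \<infinity>) \<and>
    (\<exists>C1>0. \<forall>x y. x \<noteq> y \<longrightarrow>
      \<bar>real_of_ereal (p x) - real_of_ereal (p y)\<bar> \<le> C1 / ln (exp 1 + 1 / norm (x - y)))}"

definition P_gauss_inf :: "(real ^ 'n::finite \<Rightarrow> ereal) set"
  where "P_gauss_inf = {p. exponent_function p \<and>
    (\<exists>(C::real) (p_inf::real). C > 0 \<and> p_inf \<ge> 1 \<and>
      (\<forall>x. x \<noteq> 0 \<longrightarrow> \<bar>p x - ereal p_inf\<bar> \<le> ereal (C / (norm x)\<^sup>2)))}"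


section \<open>Gaussian variable Lebesgue spaces\<close>

definition abs_powr :: "ereal \<Rightarrow> real \<Rightarrow> ennreal"
  where "abs_powr a r = (if \<bar>a\<bar> = \<infinity> then \<infinity> else ennreal (\<bar>real_of_ereal a\<bar> powr r))"

text \<open>The next three notions are meant for exponents with finite essential supremum; then the
  points with \<open>p x = \<infinity>\<close>, where \<open>real_of_ereal (p x) = 0\<close>, form a null set.\<close>

definition modular :: "(real ^ 'n::finite \<Rightarrow> ereal) \<Rightarrow> (real ^ 'n \<Rightarrow> ereal) \<Rightarrow> ennreal"
  where "modular p f = (\<integral>\<^sup>+ x. abs_powr (f x) (real_of_ereal (p x)) \<partial>\<gamma>)"

definition Lp_gauss :: "(real ^ 'n::finite \<Rightarrow> ereal) \<Rightarrow> (real ^ 'n \<Rightarrow> ereal) set"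
  where "Lp_gauss p = {f. f \<in> borel_measurable lebesgue \<and>
    (\<exists>l>0. modular p (\<lambda>x. f x / ereal l) < \<infinity>)}"

text \<open>The infimum is taken in \<^typ>\<open>ennreal\<close>, so that the infimum of the empty set is \<open>\<infinity>\<close>.\<close>

definition Lp_norm :: "(real ^ 'n::finite \<Rightarrow> ereal) \<Rightarrow> (real ^ 'n \<Rightarrow> ereal) \<Rightarrow> ennreal"
  where "Lp_norm p f = Inf {ennreal l | l. 0 < l \<and> modular p (\<lambda>x. f x / ereal l) \<le> 1}"


section \<open>The Gaussian Riesz potential\<close>

text \<open>\<open>riesz_kernel \<beta>\<close> is the kernel usually written \<open>N\<close> with index \<open>\<beta>/2\<close>. It comes from
  \<open>(-L) powr (-\<beta>/2) = 1 / Gamma (\<beta>/2) * (integral of t powr (\<beta>/2 - 1) * T t over t > 0)\<close>, with the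
  Mehler kernel of the Ornstein-Uhlenbeck semigroup \<open>T t\<close> generated by
  \<open>L = (1/2) Laplacian - <x, grad>\<close>; subtracting \<open>exp (- (norm y)\<^sup>2)\<close> accounts for the
  projection \<open>\<Pi>\<^sub>0\<close>. The \<open>t\<close>-integral converges absolutely for \<open>x \<noteq> y\<close>; the value on the
  diagonal is irrelevant.\<close>

definition riesz_kernel :: "real \<Rightarrow> real ^ 'n::finite \<Rightarrow> real ^ 'n \<Rightarrow> real"
  where "riesz_kernel \<beta> x y =
    1 / (pi powr (real CARD('n) / 2) * Gamma (\<beta> / 2)) *
    (LINT t:{0<..}|lborel. t powr (\<beta> / 2 - 1) *
      (exp (- ((norm (y - exp (- t) *\<^sub>R x))\<^sup>2 / (1 - exp (- 2 * t))))
          / (1 - exp (- 2 * t)) powr (real CARD('n) / 2)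
        - exp (- (norm y)\<^sup>2)))"

text \<open>Functions in \<open>Lp_gauss p\<close> are finite almost everywhere, so \<open>real_of_ereal\<close> below changes
  the integrand on a null set only. As the Bochner integral is 0 where the integrand is
  not integrable, \<open>riesz_defined\<close> expresses that the integral really exists.\<close>

definition riesz_defined :: "real \<Rightarrow> (real ^ 'n::finite \<Rightarrow> ereal) \<Rightarrow> real ^ 'n \<Rightarrow> bool"
  where "riesz_defined \<beta> f x \<longleftrightarrow>
    integrable lebesgue (\<lambda>y. riesz_kernel \<beta> x y * real_of_ereal (f y))"

definition riesz_potential :: "real \<Rightarrow> (real ^ 'n::finite \<Rightarrow> ereal) \<Rightarrow> real ^ 'n \<Rightarrow> ereal"
  where "riesz_potential \<beta> f x =
    ereal (LINT y|lebesgue. riesz_kernel \<beta> x y * real_of_ereal (f y))"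

end

theory Submission
  imports Defs
begin

text \<open>Write \<open>q\<close> for the limit of \<open>p\<close> at infinity and \<open>n\<close> for the dimension. The decay
\<open>\<bar>p x - q\<bar> \<le> C / (norm x)\<^sup>2\<close> says exactly that the weights \<open>exp (- (norm x)\<^sup>2)\<close> and
\<open>exp (- (norm x)\<^sup>2 / q) powr p x\<close> are comparable (\<open>weight_compare\<close>). Multiplication by
\<open>exp (- (norm x)\<^sup>2 / q)\<close> therefore identifies the Gaussian space with the variable Lebesgue space
of Lebesgue measure, and the claim becomes a claim about the kernel
\<open>exp (- (norm x)\<^sup>2 / q) * \<bar>riesz_kernel \<beta> x y\<bar> * exp ((norm y)\<^sup>2 / q)\<close> on the latter.

Conjugating the Mehler kernel in this way turns it into a kernel dominated by a convolution: the exponent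
of the Mehler kernel is half of \<open>(norm x)\<^sup>2 - (norm y)\<^sup>2\<close> minus a quarter of
\<open>\<tau> * (norm (x + y))\<^sup>2 + (norm (x - y))\<^sup>2 / \<tau>\<close> with \<open>\<tau> = (1 - exp (- t)) / (1 + exp (- t))\<close>,
and \<open>(norm x)\<^sup>2 - (norm y)\<^sup>2\<close> is the inner product of \<open>x + y\<close> and \<open>x - y\<close>. Since
\<open>1 < q < \<infinity>\<close>, the conjugation shifts the coefficient \<open>1 / 2\<close> to a number of modulus less than
\<open>1 / 2\<close>, so a fixed fraction of the negative quadratic form survives. For small \<open>t\<close> this leaves a
Gaussian in \<open>x - y\<close> of width \<open>sqrt t\<close>; for large \<open>t\<close>, the difference to the equilibrium kernel
\<open>exp (- (norm y)\<^sup>2)\<close> gains a factor \<open>exp (- t)\<close> and still decays like a Gaussian in \<open>x - y\<close>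
(\<open>conjugated_mehler_le\<close>). Hence the conjugated Riesz kernel is at most a constant times an average, over
gamma-distributed times \<open>t\<close>, of Gaussian convolution kernels of width at most 1
(\<open>riesz_kernel_le_heat_kernel\<close>).

It remains to bound Gaussian convolutions on the variable Lebesgue space uniformly in the width. A Gaussian
is at most a superposition of normalised indicators of balls with respect to a probability measure on
the radii, up to a constant. By Jensen's inequality in the exponent \<open>p x\<close> and Tonelli's theorem, a modular
bound survives superposition (\<open>lebesgue_modular_superposition\<close>), so averages over balls of arbitrary
radius suffice, and no maximal function enters. For these (\<open>lebesgue_modular_ball_average\<close>), split
\<open>F\<close> at height 1. The large part has integral at most 1, so its average over a ball of radius \<open>r\<close> is
\<open>O(1 / r ^ n)\<close>, and by local log-Hoelder continuity the error in replacing \<open>p x\<close> by the infimum of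
\<open>p\<close> over the ball is a bounded factor. On the small part, the decay of \<open>p\<close> permits replacing
\<open>p x\<close> by the constant \<open>q\<close> at the cost of a Gaussian error term.\<close>

section \<open>Powers of extended non-negative reals and modulars\<close>

text \<open>Powers are taken of integrals that may be infinite, hence a power on \<^typ>\<open>ennreal\<close>; the value at
\<open>\<infinity>\<close> makes it monotone in the base for every non-negative exponent.\<close>

definition ennpowr :: "ennreal \<Rightarrow> real \<Rightarrow> ennreal"
  where "ennpowr a r = (if a = top then top else ennreal (enn2real a powr r))"

lemma ennpowr_ennreal [simp]: "0 \<le> a \<Longrightarrow> ennpowr (ennreal a) r = ennreal (a powr r)"
  by (simp add: ennpowr_def)

lemma ennpowr_top [simp]: "ennpowr top r = top"
  by (simp add: ennpowr_def)

lemma ennpowr_0 [simp]: "ennpowr 0 r = 0"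
  by (simp add: ennpowr_def)

lemma ennpowr_one_right [simp]: "ennpowr a 1 = a"
  by (cases a) simp_all

lemma measurable_ennpowr [measurable]:
  assumes [measurable]: "f \<in> borel_measurable M" "g \<in> borel_measurable M"
  shows "(\<lambda>x. ennpowr (f x) (g x)) \<in> borel_measurable M"
  unfolding ennpowr_def by measurable

lemma ennpowr_mono:
  assumes "a \<le> b" "0 \<le> r"
  shows "ennpowr a r \<le> ennpowr b r"
proof (cases b)
  case (real v)
  then obtain u where "a = ennreal u" "0 \<le> u" using assms by (cases a) (auto simp: top_unique)
  then show ?thesis using assms real by (auto intro!: ennreal_leI powr_mono2)
qed (simp add: ennpowr_def)

lemma ennpowr_mono_exponent:
  assumes "1 \<le> a" "r \<le> s"
  shows "ennpowr a r \<le> ennpowr a s"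
proof (cases a)
  case (real u)
  then have "1 \<le> u" using assms by simp
  then show ?thesis using assms real by (auto intro!: ennreal_leI powr_mono)
qed simp

lemma ennpowr_antimono_exponent:
  assumes "a \<le> 1" "r \<le> s"
  shows "ennpowr a s \<le> ennpowr a r"
proof -
  obtain u where u: "a = ennreal u" "0 \<le> u" using assms by (cases a) (auto simp: top_unique)
  then have "u \<le> 1" using assms by simp
  then show ?thesis using assms u by (auto intro!: ennreal_leI powr_mono')
qed

lemma ennpowr_cmult:
  assumes "0 < c"
  shows "ennpowr (ennreal c * a) r = ennreal (c powr r) * ennpowr a r"
proof (cases a)
  case (real u)
  then show ?thesis using assms
    by (simp add: ennreal_mult' [symmetric] powr_mult ennreal_mult[symmetric])
next
  case top
  then show ?thesis using assms by (simp add: ennreal_mult_top)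
qed

lemma ennpowr_add_le:
  assumes "0 \<le> r"
  shows "ennpowr (a + b) r \<le> ennreal (2 powr r) * (ennpowr a r + ennpowr b r)"
proof -
  have "a + b \<le> ennreal 2 * max a b"
    using add_mono[of a "max a b" b "max a b"] by (simp add: mult_2)
  then have "ennpowr (a + b) r \<le> ennpowr (ennreal 2 * max a b) r"
    using assms by (rule ennpowr_mono)
  also have "\<dots> = ennreal (2 powr r) * ennpowr (max a b) r"
    by (rule ennpowr_cmult) simp
  also have "\<dots> \<le> ennreal (2 powr r) * (ennpowr a r + ennpowr b r)"
    by (intro mult_left_mono) (auto simp: max_def)
  finally show ?thesis .
qed

lemma ennpowr_add_exponent:
  assumes "0 < a"
  shows "ennpowr a (r + s) = ennpowr a r * ennpowr a s"
  using assms by (cases a) (auto simp: powr_add ennreal_mult)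

text \<open>The tangent line to the convex power function at \<open>m\<close>. Integrating it and choosing \<open>m\<close> at the end gives
Jensen's inequality without discussing integrability.\<close>

lemma young_ennpowr:
  assumes "1 \<le> r" "0 < m"
  shows "a \<le> ennreal (m powr (1 - r) / r) * ennpowr a r + ennreal (m * (1 - 1 / r))"
proof (cases a)
  case (real u)
  have "u / m \<le> (1 / r) * (u / m) powr r + (1 - 1 / r)"
  proof (cases "u = 0")
    case False
    then have "((u / m) powr r) powr (1 / r) * 1 powr (1 - 1 / r)
        \<le> (1 / r) * (u / m) powr r + (1 - 1 / r) * 1"
      using assms real by (intro Youngs_inequality_0) auto
    then show ?thesis using assms real by (simp add: powr_powr)
  qed (use assms in simp)
  then have "u \<le> m * ((1 / r) * (u / m) powr r + (1 - 1 / r))"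
    using assms by (simp add: field_simps)
  also have "\<dots> = m powr (1 - r) / r * u powr r + m * (1 - 1 / r)"
    using assms real by (simp add: powr_divide powr_diff distrib_left)
  finally have "ennreal u \<le> ennreal (m powr (1 - r) / r * u powr r + m * (1 - 1 / r))"
    by (rule ennreal_leI)
  also have "\<dots> = ennreal (m powr (1 - r) / r) * ennreal (u powr r) + ennreal (m * (1 - 1 / r))"
    using assms by (subst ennreal_plus) (auto simp flip: ennreal_mult)
  finally show ?thesis using real by simp
next
  case top
  then show ?thesis using assms by (simp add: ennreal_mult_top)
qed

text \<open>Jensen's inequality. Total mass below 1 is harmless, because powers of exponent at least 1 vanish at 0.\<close>

lemma ennpowr_nn_integral_le:
  assumes [measurable]: "h \<in> borel_measurable M"
    and mass: "emeasure M (space M) \<le> 1" and r: "1 \<le> r"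
  shows "ennpowr (\<integral>\<^sup>+ x. h x \<partial>M) r \<le> (\<integral>\<^sup>+ x. ennpowr (h x) r \<partial>M)"
proof (cases "\<integral>\<^sup>+ x. ennpowr (h x) r \<partial>M")
  case (real i)
  show ?thesis unfolding real
  proof (rule ennreal_le_epsilon)
    fix e :: real assume e: "0 < e"
    \<comment> \<open>The optimal tangent point is \<open>i powr (1 / r)\<close>; the \<open>e\<close> keeps it positive.\<close>
    define m where "m = (i + e) powr (1 / r)"
    have m: "0 < m" using real e by (simp add: m_def)
    have mr: "m powr r = i + e" using real e r by (simp add: m_def powr_powr)
    have "(\<integral>\<^sup>+ x. h x \<partial>M)
        \<le> (\<integral>\<^sup>+ x. ennreal (m powr (1 - r) / r) * ennpowr (h x) r + ennreal (m * (1 - 1 / r)) \<partial>M)"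
      by (intro nn_integral_mono young_ennpowr r m)
    also have "\<dots> = ennreal (m powr (1 - r) / r) * ennreal i
        + ennreal (m * (1 - 1 / r)) * emeasure M (space M)"
      using real by (subst nn_integral_add) (auto simp: nn_integral_cmult)
    also have "\<dots> \<le> ennreal (m powr (1 - r) / r) * ennreal i + ennreal (m * (1 - 1 / r)) * 1"
      by (intro add_left_mono mult_left_mono mass) simp
    also have "\<dots> = ennreal (m powr (1 - r) / r * i + m * (1 - 1 / r))"
      using m r real by (subst ennreal_plus) (auto simp flip: ennreal_mult)
    also have "\<dots> \<le> ennreal m"
    proof (rule ennreal_leI)
      have "m powr (1 - r) / r * i \<le> m powr (1 - r) / r * m powr r"
        using mr e r by (intro mult_left_mono) auto
      also have "\<dots> = m / r" using m r by (simp add: powr_diff)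
      finally show "m powr (1 - r) / r * i + m * (1 - 1 / r) \<le> m"
        by (simp add: algebra_simps)
    qed
    finally have "ennpowr (\<integral>\<^sup>+ x. h x \<partial>M) r \<le> ennpowr (ennreal m) r"
      using r by (intro ennpowr_mono) auto
    then show "ennpowr (\<integral>\<^sup>+ x. h x \<partial>M) r \<le> ennreal i + ennreal e"
      using m mr real e by simp
  qed
qed simp

definition lebesgue_modular :: "('a::euclidean_space \<Rightarrow> real) \<Rightarrow> ('a \<Rightarrow> ennreal) \<Rightarrow> ennreal"
  where "lebesgue_modular p F = (\<integral>\<^sup>+ x. ennpowr (F x) (p x) \<partial>lborel)"

lemma lebesgue_modular_mono:
  assumes "\<And>x. 1 \<le> p x" "\<And>x. F x \<le> G x"
  shows "lebesgue_modular p F \<le> lebesgue_modular p G"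
  unfolding lebesgue_modular_def
  by (intro nn_integral_mono ennpowr_mono assms) (use assms(1) order_trans zero_le_one in blast)

lemma lebesgue_modular_cmult:
  assumes [measurable]: "p \<in> borel_measurable borel" "F \<in> borel_measurable borel"
    and p: "\<And>x. 1 \<le> p x" "\<And>x. p x \<le> P" and c: "1 \<le> c"
  shows "lebesgue_modular p (\<lambda>x. ennreal c * F x) \<le> ennreal (c powr P) * lebesgue_modular p F"
proof -
  have "lebesgue_modular p (\<lambda>x. ennreal c * F x)
      = (\<integral>\<^sup>+ x. ennreal (c powr p x) * ennpowr (F x) (p x) \<partial>lborel)"
    using c by (simp add: lebesgue_modular_def ennpowr_cmult)
  also have "\<dots> \<le> (\<integral>\<^sup>+ x. ennreal (c powr P) * ennpowr (F x) (p x) \<partial>lborel)"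
    using c p by (intro nn_integral_mono mult_right_mono ennreal_leI powr_mono) auto
  finally show ?thesis by (simp add: lebesgue_modular_def nn_integral_cmult)
qed

lemma lebesgue_modular_add:
  assumes [measurable]: "p \<in> borel_measurable borel"
      "F \<in> borel_measurable borel" "G \<in> borel_measurable borel"
    and p: "\<And>x. 1 \<le> p x" "\<And>x. p x \<le> P"
  shows "lebesgue_modular p (\<lambda>x. F x + G x)
    \<le> ennreal (2 powr P) * (lebesgue_modular p F + lebesgue_modular p G)"
proof -
  have "lebesgue_modular p (\<lambda>x. F x + G x)
      \<le> (\<integral>\<^sup>+ x. ennreal (2 powr P) * (ennpowr (F x) (p x) + ennpowr (G x) (p x)) \<partial>lborel)"
    unfolding lebesgue_modular_def
  proof (intro nn_integral_mono)
    fix x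
    have "0 \<le> p x" using p(1)[of x] by simp
    then have "ennpowr (F x + G x) (p x)
        \<le> ennreal (2 powr p x) * (ennpowr (F x) (p x) + ennpowr (G x) (p x))"
      by (rule ennpowr_add_le)
    also have "\<dots> \<le> ennreal (2 powr P) * (ennpowr (F x) (p x) + ennpowr (G x) (p x))"
      using p(2) by (intro mult_right_mono ennreal_leI powr_mono) auto
    finally show "ennpowr (F x + G x) (p x)
        \<le> ennreal (2 powr P) * (ennpowr (F x) (p x) + ennpowr (G x) (p x))" .
  qed
  then show ?thesis by (simp add: lebesgue_modular_def nn_integral_cmult nn_integral_add)
qed

text \<open>Jensen's inequality at each point \<open>x\<close>, with the exponent \<open>p x\<close>, followed by Tonelli: averages of
operators with a common modular bound obey the same bound.\<close>

lemma lebesgue_modular_superposition: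
  assumes "sigma_finite_measure M" and mass: "emeasure M (space M) \<le> 1"
    and h [measurable]: "case_prod h \<in> borel_measurable (M \<Otimes>\<^sub>M borel)"
    and [measurable]: "p \<in> borel_measurable borel" and p: "\<And>x. 1 \<le> p x"
    and bound: "AE s in M. lebesgue_modular p (h s) \<le> C"
  shows "lebesgue_modular p (\<lambda>x. \<integral>\<^sup>+ s. h s x \<partial>M) \<le> C"
proof -
  interpret M: sigma_finite_measure M by fact
  interpret pair_sigma_finite M lborel ..
  have "lebesgue_modular p (\<lambda>x. \<integral>\<^sup>+ s. h s x \<partial>M)
      \<le> (\<integral>\<^sup>+ x. \<integral>\<^sup>+ s. ennpowr (h s x) (p x) \<partial>M \<partial>lborel)"
    unfolding lebesgue_modular_def
    by (intro nn_integral_mono ennpowr_nn_integral_le mass p) measurable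
  also have "\<dots> = (\<integral>\<^sup>+ s. lebesgue_modular p (h s) \<partial>M)"
    unfolding lebesgue_modular_def by (rule Fubini') measurable
  also have "\<dots> \<le> (\<integral>\<^sup>+ s. C \<partial>M)"
    by (intro nn_integral_mono_AE bound)
  also have "\<dots> = C * emeasure M (space M)" by simp
  also have "\<dots> \<le> C * 1"
    by (intro mult_left_mono mass) simp
  finally show ?thesis by simp
qed

section \<open>Averages over balls\<close>

definition ball_average :: "real \<Rightarrow> ('a::euclidean_space \<Rightarrow> ennreal) \<Rightarrow> 'a \<Rightarrow> ennreal"
  where "ball_average r F x =
    ennreal (1 / (unit_ball_vol DIM('a) * r ^ DIM('a))) * (\<integral>\<^sup>+ y. indicator (ball x r) y * F y \<partial>lborel)"

lemma measurable_indicator_ball [measurable]: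
  fixes f g :: "'b \<Rightarrow> 'a::euclidean_space"
  assumes [measurable]: "f \<in> borel_measurable M" "g \<in> borel_measurable M" "\<rho> \<in> borel_measurable M"
  shows "(\<lambda>z. indicator (ball (f z) (\<rho> z)) (g z) :: ennreal) \<in> borel_measurable M"
proof -
  have "(\<lambda>z. indicator (ball (f z) (\<rho> z)) (g z) :: ennreal)
      = (\<lambda>z. if dist (f z) (g z) < \<rho> z then 1 else 0)"
    by (auto simp: indicator_def)
  also have "\<dots> \<in> borel_measurable M" by measurable
  finally show ?thesis .
qed

lemma measurable_ball_average [measurable]:
  fixes F :: "'a::euclidean_space \<Rightarrow> ennreal"
  assumes [measurable]: "F \<in> borel_measurable borel" "f \<in> borel_measurable M" "\<rho> \<in> borel_measurable M"
  shows "(\<lambda>z. ball_average (\<rho> z) F (f z)) \<in> borel_measurable M"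
  unfolding ball_average_def by measurable

lemma ball_average_add:
  assumes [measurable]: "F \<in> borel_measurable borel" "G \<in> borel_measurable borel"
  shows "ball_average r (\<lambda>y. F y + G y) x = ball_average r F x + ball_average r G x"
  by (simp add: ball_average_def distrib_left nn_integral_add)

lemma ball_average_mono:
  assumes "\<And>y. y \<in> ball x r \<Longrightarrow> F y \<le> G y"
  shows "ball_average r F x \<le> ball_average r G x"
  unfolding ball_average_def
proof (rule mult_left_mono, rule nn_integral_mono)
  fix y show "indicator (ball x r) y * F y \<le> indicator (ball x r) y * G y"
    using assms[of y] by (cases "y \<in> ball x r") (simp_all del: mem_ball)
qed simp

lemma ball_average_eq_density:
  fixes F :: "'a::euclidean_space \<Rightarrow> ennreal"
  assumes [measurable]: "F \<in> borel_measurable borel"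
  shows "ball_average r F x = (\<integral>\<^sup>+ y. F y \<partial>density lborel
    (\<lambda>y. ennreal (1 / (unit_ball_vol DIM('a) * r ^ DIM('a))) * indicator (ball x r) y))"
  by (simp add: ball_average_def nn_integral_density nn_integral_cmult mult.assoc)

lemma nn_integral_ball_weight:
  fixes x :: "'a::euclidean_space"
  assumes "0 < r"
  shows "(\<integral>\<^sup>+ y. ennreal (1 / (unit_ball_vol DIM('a) * r ^ DIM('a))) * indicator (ball x r) y \<partial>lborel) = 1"
proof -
  have v: "unit_ball_vol DIM('a) \<noteq> 0"
    using unit_ball_vol_pos[of "real DIM('a)"] by (metis less_irrefl of_nat_0_le_iff)
  have "(\<integral>\<^sup>+ y. ennreal (1 / (unit_ball_vol DIM('a) * r ^ DIM('a))) * indicator (ball x r) y \<partial>lborel)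
      = ennreal (1 / (unit_ball_vol DIM('a) * r ^ DIM('a))) * ennreal (unit_ball_vol DIM('a) * r ^ DIM('a))"
    using assms by (subst nn_integral_cmult) (simp_all add: emeasure_ball)
  also have "\<dots> = 1" using assms v by (subst ennreal_mult[symmetric]) auto
  finally show ?thesis .
qed

lemma ennpowr_ball_average_le:
  assumes [measurable]: "F \<in> borel_measurable borel" and r: "0 < r" "1 \<le> s"
  shows "ennpowr (ball_average r F x) s \<le> ball_average r (\<lambda>y. ennpowr (F y) s) x"
proof -
  let ?M = "density lborel (\<lambda>y::'a. ennreal (1 / (unit_ball_vol DIM('a) * r ^ DIM('a))) * indicator (ball x r) y)"
  have "emeasure ?M (space ?M) = 1"
    using nn_integral_ball_weight[OF r(1), of x] by (simp add: emeasure_density)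
  then show ?thesis
    by (subst (1 2) ball_average_eq_density) (auto intro!: ennpowr_nn_integral_le r(2))
qed

text \<open>Tonelli and the symmetry of \<open>y \<in> ball x r\<close> in \<open>x\<close> and \<open>y\<close>.\<close>

lemma nn_integral_ball_average:
  fixes F :: "'a::euclidean_space \<Rightarrow> ennreal"
  assumes [measurable]: "F \<in> borel_measurable borel" and r: "0 < r"
  shows "(\<integral>\<^sup>+ x. ball_average r F x \<partial>lborel) = (\<integral>\<^sup>+ y. F y \<partial>lborel)"
proof -
  let ?c = "ennreal (1 / (unit_ball_vol DIM('a) * r ^ DIM('a)))"
  have "(\<integral>\<^sup>+ x. ball_average r F x \<partial>lborel)
      = (\<integral>\<^sup>+ x. \<integral>\<^sup>+ y. ?c * indicator (ball x r) y * F y \<partial>lborel \<partial>lborel)"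
    unfolding ball_average_def by (simp add: nn_integral_cmult mult.assoc)
  also have "\<dots> = (\<integral>\<^sup>+ y. \<integral>\<^sup>+ x. ?c * indicator (ball x r) y * F y \<partial>lborel \<partial>lborel)"
    by (rule lborel_pair.Fubini') measurable
  also have "\<dots> = (\<integral>\<^sup>+ y. (\<integral>\<^sup>+ x. ?c * indicator (ball y r) x \<partial>lborel) * F y \<partial>lborel)"
  proof (intro nn_integral_cong)
    fix y :: 'a
    have "indicator (ball x r) y = (indicator (ball y r) x :: ennreal)" for x
      by (simp add: indicator_def dist_commute)
    then show "(\<integral>\<^sup>+ x. ?c * indicator (ball x r) y * F y \<partial>lborel)
        = (\<integral>\<^sup>+ x. ?c * indicator (ball y r) x \<partial>lborel) * F y"
      by (simp only:) (rule nn_integral_multc, measurable)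
  qed
  finally show ?thesis by (simp add: nn_integral_ball_weight r)
qed

lemma ball_average_le_nn_integral:
  fixes F :: "'a::euclidean_space \<Rightarrow> ennreal"
  shows "ball_average r F x
    \<le> ennreal (1 / (unit_ball_vol DIM('a) * r ^ DIM('a))) * (\<integral>\<^sup>+ y. F y \<partial>lborel)"
  unfolding ball_average_def
  by (intro mult_left_mono nn_integral_mono) (auto simp: indicator_def)

lemma ball_average_le_1:
  assumes [measurable]: "F \<in> borel_measurable borel" and "0 < r" "\<And>y. F y \<le> 1"
  shows "ball_average r F x \<le> 1"
proof -
  have "ball_average r F x \<le> ball_average r (\<lambda>y. 1) x"
    by (intro ball_average_mono assms)
  also have "\<dots> = 1"
    using nn_integral_ball_weight[OF \<open>0 < r\<close>, of x] by (simp add: ball_average_def nn_integral_cmult)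
  finally show ?thesis .
qed

section \<open>Gaussians as superpositions of balls\<close>

lemma nn_integral_power_tail:
  fixes a :: real
  assumes "0 < a" "0 < n"
  shows "(\<integral>\<^sup>+ z. ennreal (1 / z ^ Suc n) * indicator {a..} z \<partial>lborel) = ennreal (1 / (n * a ^ n))"
proof -
  have "(\<integral>\<^sup>+ z. ennreal (1 / z ^ Suc n) * indicator {a..} z \<partial>lborel) = 0 - (- 1 / (n * a ^ n))"
  proof (rule nn_integral_FTC_atLeast)
    fix z assume "a \<le> z"
    then have z: "0 < z" using assms by simp
    show "((\<lambda>z. - 1 / (n * z ^ n)) has_real_derivative 1 / z ^ Suc n) (at z)"
    proof -
      obtain m where n: "n = Suc m" using assms(2) gr0_implies_Suc by blast
      have "((\<lambda>z. - (1 / n) * inverse (z ^ n)) has_real_derivative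
          - (1 / n) * (- (inverse (z ^ n) * (n * z ^ (n - 1)) * inverse (z ^ n)))) (at z)"
        using z assms by (auto intro!: derivative_eq_intros)
      also have "- (1 / n) * (- (inverse (z ^ n) * (n * z ^ (n - 1)) * inverse (z ^ n))) = 1 / z ^ Suc n"
        using z by (simp add: n divide_simps)
      finally show ?thesis by (simp add: divide_inverse)
    qed
    show "0 \<le> 1 / z ^ Suc n" using z by simp
  next
    have "filterlim (\<lambda>z::real. z ^ n) at_top at_top"
      by (rule filterlim_pow_at_top[OF assms(2) filterlim_ident])
    then have "filterlim (\<lambda>z::real. real n * z ^ n) at_top at_top"
      using assms(2) by (intro filterlim_tendsto_pos_mult_at_top[OF tendsto_const]) auto
    then have "filterlim (\<lambda>z::real. real n * z ^ n) at_infinity at_top"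
      by (rule filterlim_at_top_imp_at_infinity)
    then show "((\<lambda>z. - 1 / (real n * z ^ n)) \<longlongrightarrow> 0) at_top"
      by (rule tendsto_divide_0[OF tendsto_const])
  qed measurable
  then show ?thesis by simp
qed

lemma exp_neg_square_le_power:
  fixes k \<rho> :: real
  assumes "0 < k" "0 \<le> \<rho>" "0 < n"
  shows "exp (- (k * \<rho>\<^sup>2)) \<le> (1 + (n / k) ^ n) / (max 1 \<rho>) ^ n"
proof (cases "1 \<le> \<rho>")
  case True
  have nonneg: "0 \<le> k * \<rho>\<^sup>2" using assms by simp
  have "(k * \<rho>\<^sup>2 / n) ^ n \<le> (1 + k * \<rho>\<^sup>2 / n) ^ n"
    using assms by (intro power_mono) auto
  also have "\<dots> \<le> exp (k * \<rho>\<^sup>2)"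
    using assms nonneg by (intro exp_ge_one_plus_x_over_n_power_n) linarith+
  finally have "1 / exp (k * \<rho>\<^sup>2) \<le> 1 / (k * \<rho>\<^sup>2 / n) ^ n"
    using assms True by (intro divide_left_mono) auto
  also have "\<dots> = (n / k) ^ n / (\<rho>\<^sup>2) ^ n"
    using assms by (simp add: power_mult_distrib power_divide)
  also have "\<dots> \<le> (n / k) ^ n / \<rho> ^ n"
    using assms True by (intro divide_left_mono power_mono) (auto simp: power2_eq_square)
  also have "\<dots> \<le> (1 + (n / k) ^ n) / \<rho> ^ n"
    using assms True by (intro divide_right_mono) auto
  finally show ?thesis using True by (simp add: max_def exp_minus inverse_eq_divide)
next
  case False
  have "exp (- (k * \<rho>\<^sup>2)) \<le> 1" using assms by simp
  also have "1 \<le> 1 + (n / k) ^ n" using assms by simp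
  finally show ?thesis using False by (simp add: max_def)
qed

text \<open>The layer-cake representation of a power that dominates the Gaussian. A power law is used because its
layers have an explicit density.\<close>

lemma exp_neg_square_le_tail:
  fixes k \<rho> :: real
  assumes "0 < k" "0 \<le> \<rho>" "0 < n"
  shows "ennreal (exp (- (k * \<rho>\<^sup>2))) \<le> ennreal (n * (1 + (n / k) ^ n)) *
    (\<integral>\<^sup>+ z. ennreal (1 / z ^ Suc n) * indicator {1..} z * indicator {\<rho><..} z \<partial>lborel)"
proof -
  have "ennreal (exp (- (k * \<rho>\<^sup>2))) \<le> ennreal ((1 + (n / k) ^ n) / (max 1 \<rho>) ^ n)"
    by (intro ennreal_leI exp_neg_square_le_power assms)
  also have "\<dots> = ennreal (n * (1 + (n / k) ^ n)) * ennreal (1 / (n * (max 1 \<rho>) ^ n))"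
    using assms by (subst ennreal_mult[symmetric]) auto
  also have "ennreal (1 / (n * (max 1 \<rho>) ^ n))
      = (\<integral>\<^sup>+ z. ennreal (1 / z ^ Suc n) * indicator {max 1 \<rho>..} z \<partial>lborel)"
    using assms by (subst nn_integral_power_tail) auto
  also have "\<dots> = (\<integral>\<^sup>+ z. ennreal (1 / z ^ Suc n) * indicator {1..} z * indicator {\<rho><..} z \<partial>lborel)"
  proof (rule nn_integral_cong_AE)
    show "AE z in lborel. ennreal (1 / z ^ Suc n) * indicator {max 1 \<rho>..} z
        = ennreal (1 / z ^ Suc n) * indicator {1..} z * indicator {\<rho><..} z"
      using AE_lborel_singleton[of \<rho>] by eventually_elim (auto simp: indicator_def)
  qed
  finally show ?thesis .
qed

text \<open>In the layer-cake bound with \<open>n = DIM('a) + 1\<close>, the layer at height \<open>z\<close> is a ball of volume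
proportional to \<open>z ^ DIM('a)\<close>, which leaves the integrable density \<open>1 / z\<^sup>2\<close>.\<close>

lemma nn_integral_exp_neg_norm_square_finite:
  "(\<integral>\<^sup>+ x. ennreal (exp (- (norm (x::'a::euclidean_space))\<^sup>2)) \<partial>lborel) < top"
proof -
  let ?D = "DIM('a)"
  let ?v = "unit_ball_vol ?D"
  let ?K = "ennreal (Suc ?D * (1 + (Suc ?D / 1) ^ Suc ?D))"
  have "(\<integral>\<^sup>+ x. ennreal (exp (- (norm (x::'a))\<^sup>2)) \<partial>lborel)
      \<le> (\<integral>\<^sup>+ x. ?K * (\<integral>\<^sup>+ z. ennreal (1 / z ^ Suc (Suc ?D)) * indicator {1..} z
            * indicator (ball 0 z) (x::'a) \<partial>lborel) \<partial>lborel)"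
  proof (intro nn_integral_mono)
    fix x :: 'a
    have "indicator {norm x<..} z = (indicator (ball 0 z) x :: ennreal)" for z
      by (simp add: indicator_def)
    then show "ennreal (exp (- (norm x)\<^sup>2)) \<le> ?K * (\<integral>\<^sup>+ z. ennreal (1 / z ^ Suc (Suc ?D)) * indicator {1..} z
            * indicator (ball 0 z) x \<partial>lborel)"
      using exp_neg_square_le_tail[of 1 "norm x" "Suc ?D"] by simp
  qed
  also have "\<dots> = ?K * (\<integral>\<^sup>+ x. \<integral>\<^sup>+ z. ennreal (1 / z ^ Suc (Suc ?D)) * indicator {1..} z
            * indicator (ball 0 z) (x::'a) \<partial>lborel \<partial>lborel)"
    by (intro nn_integral_cmult) measurable
  also have "(\<integral>\<^sup>+ x. \<integral>\<^sup>+ z. ennreal (1 / z ^ Suc (Suc ?D)) * indicator {1..} z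
            * indicator (ball 0 z) (x::'a) \<partial>lborel \<partial>lborel)
      = (\<integral>\<^sup>+ z. \<integral>\<^sup>+ x. ennreal (1 / z ^ Suc (Suc ?D)) * indicator {1..} z
            * indicator (ball 0 z) (x::'a) \<partial>lborel \<partial>lborel)"
    by (rule lborel_pair.Fubini') measurable
  also have "\<dots> = (\<integral>\<^sup>+ z. ennreal ?v * (ennreal (1 / z ^ Suc 1) * indicator {1..} z) \<partial>lborel)"
  proof (intro nn_integral_cong)
    fix z :: real
    show "(\<integral>\<^sup>+ x. ennreal (1 / z ^ Suc (Suc ?D)) * indicator {1..} z * indicator (ball 0 z) (x::'a) \<partial>lborel)
        = ennreal ?v * (ennreal (1 / z ^ Suc 1) * indicator {1..} z)"
    proof (cases "1 \<le> z")
      case True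
      have "(\<integral>\<^sup>+ x. ennreal (1 / z ^ Suc (Suc ?D)) * indicator {1..} z * indicator (ball 0 z) (x::'a) \<partial>lborel)
          = ennreal (1 / z ^ Suc (Suc ?D)) * ennreal (?v * z ^ ?D)"
        using True by (simp add: nn_integral_cmult emeasure_ball)
      also have "\<dots> = ennreal (1 / z ^ Suc (Suc ?D) * (?v * z ^ ?D))"
        using True by (intro ennreal_mult[symmetric]) auto
      also have "1 / z ^ Suc (Suc ?D) * (?v * z ^ ?D) = ?v * (1 / z ^ Suc 1)"
        using True by simp
      also have "ennreal \<dots> = ennreal ?v * ennreal (1 / z ^ Suc 1)"
        using True by (intro ennreal_mult) auto
      finally show ?thesis using True by simp
    qed simp
  qed
  also have "\<dots> = ennreal ?v * (\<integral>\<^sup>+ z. ennreal (1 / z ^ Suc 1) * indicator {1..} z \<partial>lborel)"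
    by (rule nn_integral_cmult) measurable
  also have "(\<integral>\<^sup>+ z. ennreal (1 / z ^ Suc 1) * indicator {1..} z \<partial>lborel) = ennreal (1 / (real 1 * 1 ^ 1))"
    by (rule nn_integral_power_tail) auto
  also have "?K * (ennreal ?v * ennreal (1 / (real 1 * 1 ^ 1))) < top"
    by (simp add: ennreal_mult_less_top)
  finally show ?thesis .
qed

section \<open>Ball averages in variable exponent spaces\<close>

text \<open>The decay towards \<open>q\<close> at infinity is multiplied out so that it includes the origin. Its rate
\<open>1 / (norm x)\<^sup>2\<close> is the one dictated by the Gaussian weight, and is stronger than the logarithmic
decay customary for Lebesgue measure.\<close>

locale log_hoelder_exponent =
  fixes p :: "'a::euclidean_space \<Rightarrow> real" and P q C\<^sub>0 C\<^sub>1 :: real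
  assumes measurable_p [measurable]: "p \<in> borel_measurable borel"
    and p_ge_1: "1 \<le> p x" and p_le: "p x \<le> P"
    and local_log_hoelder: "x \<noteq> y \<Longrightarrow> \<bar>p x - p y\<bar> \<le> C\<^sub>0 / ln (exp 1 + 1 / norm (x - y))"
    and decay: "\<bar>p x - q\<bar> * (norm x)\<^sup>2 \<le> C\<^sub>1"
    and C\<^sub>0_nonneg: "0 \<le> C\<^sub>0" and q_ge_1: "1 \<le> q"
begin

lemma C\<^sub>1_nonneg: "0 \<le> C\<^sub>1"
  using decay[of 0] by simp

lemma exponent_oscillation_ball:
  assumes "0 < r" "y \<in> ball x r"
  shows "p x - C\<^sub>0 / ln (exp 1 + 1 / r) \<le> p y"
proof (cases "x = y")
  case True
  have "1 \<le> exp 1 + 1 / r" using assms(1) exp_ge_add_one_self[of 1] by (simp add: add_increasing2)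
  then show ?thesis using C\<^sub>0_nonneg True by simp
next
  case False
  then have n: "0 < norm (x - y)" "norm (x - y) < r" using assms by (auto simp: dist_norm)
  have "exp 1 + 1 / r \<le> exp 1 + 1 / norm (x - y)"
    using n by (simp add: frac_le)
  moreover have "1 < exp 1 + 1 / r"
  proof -
    have "1 < exp (1::real)" "0 < 1 / r" using assms(1) by simp_all
    then show ?thesis by linarith
  qed
  ultimately have "C\<^sub>0 / ln (exp 1 + 1 / norm (x - y)) \<le> C\<^sub>0 / ln (exp 1 + 1 / r)"
    using C\<^sub>0_nonneg by (intro divide_left_mono) auto
  then show ?thesis using local_log_hoelder[OF False] by linarith
qed

text \<open>A bound for \<open>(1 / volume of the ball) powr oscillation\<close>, uniform in the radius: the oscillation is
at most \<open>C\<^sub>0 / ln (exp 1 + 1 / r)\<close>, while the logarithm of the reciprocal volume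
exceeds \<open>DIM('a) * ln (exp 1 + 1 / r)\<close> by at most a constant.\<close>

definition osc_const :: real
  where "osc_const = (max 1 (1 / unit_ball_vol DIM('a))) powr C\<^sub>0 * exp (DIM('a) * C\<^sub>0)"

lemma volume_powr_oscillation_le:
  assumes r: "0 < r" and \<eta>: "\<eta> = C\<^sub>0 / ln (exp 1 + 1 / r)"
  shows "max 1 (1 / (unit_ball_vol DIM('a) * r ^ DIM('a))) powr \<eta> \<le> osc_const"
proof -
  let ?D = "DIM('a)" and ?v = "unit_ball_vol DIM('a)" and ?L = "ln (exp 1 + 1 / r)"
  have v: "0 < ?v" by simp
  have L1: "1 \<le> ?L" using r by (subst ln_ge_iff) (auto intro: add_pos_pos)
  have \<eta>0: "0 \<le> \<eta>" "\<eta> \<le> C\<^sub>0"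
    using L1 C\<^sub>0_nonneg unfolding \<eta> by (auto simp: divide_le_eq mult_left_mono[of 1 _ C\<^sub>0, simplified] intro!: divide_nonneg_nonneg)
  have "1 / (?v * r ^ ?D) = (1 / ?v) * (1 / r) ^ ?D" by (simp add: power_divide)
  also have "\<dots> \<le> max 1 (1 / ?v) * (exp 1 + 1 / r) ^ ?D"
    using v r by (intro mult_mono power_mono) auto
  finally have 1: "1 / (?v * r ^ ?D) \<le> max 1 (1 / ?v) * (exp 1 + 1 / r) ^ ?D" .
  have e1: "1 \<le> exp 1 + 1 / r" using r exp_ge_add_one_self[of 1] by (simp add: add_increasing2)
  have "1 * 1 \<le> max 1 (1 / ?v) * (exp 1 + 1 / r) ^ ?D"
    using e1 by (intro mult_mono one_le_power) auto
  with 1 have "max 1 (1 / (?v * r ^ ?D)) powr \<eta> \<le> (max 1 (1 / ?v) * (exp 1 + 1 / r) ^ ?D) powr \<eta>"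
    using \<eta>0 by (intro powr_mono2) auto
  also have "\<dots> = max 1 (1 / ?v) powr \<eta> * ((exp 1 + 1 / r) ^ ?D) powr \<eta>"
    by (rule powr_mult)
  also have "((exp 1 + 1 / r) ^ ?D) powr \<eta> = exp (?D * C\<^sub>0)"
  proof -
    have "((exp 1 + 1 / r) ^ ?D) powr \<eta> = exp (\<eta> * (?D * ?L))"
      using e1 by (simp add: powr_def ln_realpow)
    also have "\<eta> * (?D * ?L) = ?D * C\<^sub>0" using L1 by (simp add: \<eta>)
    finally show ?thesis .
  qed
  also have "max 1 (1 / ?v) powr \<eta> * exp (?D * C\<^sub>0) \<le> osc_const"
    unfolding osc_const_def using \<eta>0 by (intro mult_right_mono powr_mono) auto
  finally show ?thesis .
qed

text \<open>If the average \<open>a\<close> exceeds 1, factor \<open>a powr p x\<close> as \<open>a powr (p x - s) * a powr s\<close>, where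
\<open>s\<close> is a lower bound for \<open>p\<close> on the ball. The first factor is bounded because \<open>a\<close> is at most the
reciprocal volume of the ball; Jensen applies to the second, and raising the exponent from \<open>s\<close> to
\<open>p y\<close> only increases a function with values in \<open>{0} \<union> [1, \<infinity>]\<close>.\<close>

lemma ball_average_large_part:
  assumes [measurable]: "F \<in> borel_measurable borel" and r: "0 < r"
    and large: "\<And>y. F y = 0 \<or> 1 \<le> F y"
    and mass: "(\<integral>\<^sup>+ y. F y \<partial>lborel) \<le> 1"
  shows "ennpowr (ball_average r F x) (p x)
    \<le> ball_average r F x + ennreal osc_const * ball_average r (\<lambda>y. ennpowr (F y) (p y)) x"
proof (cases "ball_average r F x \<le> 1")
  case True
  then have "ennpowr (ball_average r F x) (p x) \<le> ennpowr (ball_average r F x) 1"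
    by (intro ennpowr_antimono_exponent p_ge_1)
  then show ?thesis by (simp add: add_increasing2)
next
  case False
  define a where "a = ball_average r F x"
  define \<eta> where "\<eta> = C\<^sub>0 / ln (exp 1 + 1 / r)"
  define s where "s = max 1 (p x - \<eta>)"
  let ?V = "1 / (unit_ball_vol DIM('a) * r ^ DIM('a))"
  have a1: "1 < a" using False by (simp add: a_def)
  have "a \<le> ennreal ?V * (\<integral>\<^sup>+ y. F y \<partial>lborel)"
    unfolding a_def by (rule ball_average_le_nn_integral)
  also have "\<dots> \<le> ennreal ?V * 1" by (intro mult_left_mono mass) simp
  finally have aV: "a \<le> ennreal (max 1 ?V)"
    by (simp add: ennreal_leI order_trans[OF _ ennreal_leI])
  have \<eta>0: "0 \<le> \<eta>" using exponent_oscillation_ball[OF r, of x x] r by (simp add: \<eta>_def)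
  have s: "1 \<le> s" "s \<le> p x" "p x - s \<le> \<eta>"
    using p_ge_1[of x] \<eta>0 by (auto simp: s_def)
  have "ennpowr a (p x) = ennpowr a (p x - s) * ennpowr a s"
    using a1 by (subst ennpowr_add_exponent[symmetric]) (auto intro: le_less_trans)
  also have "ennpowr a (p x - s) \<le> ennpowr a \<eta>"
    using a1 s by (intro ennpowr_mono_exponent) auto
  also have "\<dots> \<le> ennpowr (ennreal (max 1 ?V)) \<eta>"
    by (intro ennpowr_mono aV \<eta>0)
  also have "\<dots> \<le> ennreal osc_const"
    using volume_powr_oscillation_le[OF r \<eta>_def] by (simp add: ennreal_leI)
  also have "ennpowr a s \<le> ball_average r (\<lambda>y. ennpowr (F y) s) x"
    unfolding a_def by (intro ennpowr_ball_average_le r s) measurable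
  also have "\<dots> \<le> ball_average r (\<lambda>y. ennpowr (F y) (p y)) x"
  proof (rule ball_average_mono)
    fix y assume "y \<in> ball x r"
    then have "s \<le> p y"
      using exponent_oscillation_ball[OF r, of y x] p_ge_1[of y] by (auto simp: s_def \<eta>_def)
    then show "ennpowr (F y) s \<le> ennpowr (F y) (p y)"
      using large[of y] by (auto intro: ennpowr_mono_exponent)
  qed
  finally show ?thesis by (simp add: a_def mult_mono add_increasing)
qed

text \<open>If \<open>u\<close> is at least \<open>exp (- (norm x)\<^sup>2)\<close>, then changing the exponent by at most
\<open>C\<^sub>1 / (norm x)\<^sup>2\<close> costs a factor of at most \<open>exp C\<^sub>1\<close>; otherwise the error term alone dominates.
This is used in both directions between \<open>p x\<close> and \<open>q\<close>.\<close>

lemma small_power_compare: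
  assumes "u \<le> 1" "1 \<le> r" "1 \<le> s" and rs: "\<bar>r - s\<bar> * (norm x)\<^sup>2 \<le> C\<^sub>1"
  shows "ennpowr u r \<le> ennreal (exp C\<^sub>1) * ennpowr u s + ennreal (exp (- (norm (x::'a))\<^sup>2))"
proof (cases "u \<le> ennreal (exp (- (norm x)\<^sup>2))")
  case True
  have "ennpowr u r \<le> ennpowr u 1" using assms by (intro ennpowr_antimono_exponent) auto
  with True show ?thesis by (simp add: add_increasing)
next
  case False
  obtain w where w: "u = ennreal w" "0 \<le> w" using assms(1) by (cases u) (auto simp: top_unique)
  have w1: "exp (- (norm x)\<^sup>2) < w" "w \<le> 1" using False assms(1) w by auto
  then have w0: "0 < w" by (meson exp_gt_zero less_trans)
  have lnw: "- (norm x)\<^sup>2 < ln w" "ln w \<le> 0"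
    using w0 w1 ln_less_cancel_iff[of "exp (- (norm x)\<^sup>2)" w] by auto
  have "(r - s) * ln w \<le> \<bar>r - s\<bar> * (norm x)\<^sup>2"
  proof -
    have "(r - s) * ln w \<le> \<bar>r - s\<bar> * \<bar>ln w\<bar>" by (metis abs_ge_self abs_mult)
    also have "\<dots> \<le> \<bar>r - s\<bar> * (norm x)\<^sup>2" using lnw by (intro mult_left_mono) auto
    finally show ?thesis .
  qed
  then have "(r - s) * ln w \<le> C\<^sub>1" using rs by linarith
  then have "w powr r \<le> exp C\<^sub>1 * w powr s"
    using w0 by (simp add: powr_def algebra_simps flip: exp_add)
  then have "ennpowr u r \<le> ennreal (exp C\<^sub>1 * w powr s)" using w by (simp add: ennreal_leI)
  also have "\<dots> = ennreal (exp C\<^sub>1) * ennpowr u s" using w by (simp add: ennreal_mult)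
  finally show ?thesis by (simp add: add_increasing2)
qed

text \<open>Passing from \<open>p x\<close> to the constant \<open>q\<close> outside the average and from \<open>q\<close> to \<open>p y\<close> inside,
with Jensen for the exponent \<open>q\<close> in between. The averages at \<open>x\<close> may involve points \<open>y\<close> that are
far away, so the two exponents cannot be compared directly.\<close>

lemma ball_average_small_part:
  assumes [measurable]: "F \<in> borel_measurable borel" and r: "0 < r" and small: "\<And>y. F y \<le> 1"
  shows "ennpowr (ball_average r F x) (p x)
    \<le> ennreal (exp C\<^sub>1) * ball_average r (\<lambda>y. ennreal (exp C\<^sub>1) * ennpowr (F y) (p y)
        + ennreal (exp (- (norm y)\<^sup>2))) x + ennreal (exp (- (norm x)\<^sup>2))"
proof -
  have "ennpowr (ball_average r F x) (p x)
      \<le> ennreal (exp C\<^sub>1) * ennpowr (ball_average r F x) q + ennreal (exp (- (norm x)\<^sup>2))"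
    by (intro small_power_compare ball_average_le_1 small r p_ge_1 q_ge_1 decay) measurable
  also have "ennpowr (ball_average r F x) q \<le> ball_average r (\<lambda>y. ennpowr (F y) q) x"
    by (intro ennpowr_ball_average_le r q_ge_1) measurable
  also have "\<dots> \<le> ball_average r (\<lambda>y. ennreal (exp C\<^sub>1) * ennpowr (F y) (p y)
        + ennreal (exp (- (norm y)\<^sup>2))) x"
    by (intro ball_average_mono small_power_compare small p_ge_1 q_ge_1)
       (subst abs_minus_commute, rule decay)
  finally show ?thesis by (simp add: mult_left_mono add_right_mono)
qed

definition gauss_mass :: ennreal
  where "gauss_mass = (\<integral>\<^sup>+ x. ennreal (exp (- (norm (x::'a))\<^sup>2)) \<partial>lborel)"

lemma gauss_mass_finite: "gauss_mass < top"
  unfolding gauss_mass_def by (rule nn_integral_exp_neg_norm_square_finite)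

definition ball_const :: ennreal
  where "ball_const = ennreal (2 powr P) * ((1 + ennreal osc_const) +
    (ennreal (exp C\<^sub>1) * (ennreal (exp C\<^sub>1) + gauss_mass) + gauss_mass))"

lemma ball_const_finite: "ball_const < top"
  using gauss_mass_finite by (simp add: ball_const_def ennreal_mult_less_top)

lemma lebesgue_modular_ball_average:
  assumes F [measurable]: "F \<in> borel_measurable borel" and "lebesgue_modular p F \<le> 1" and r: "0 < r"
  shows "lebesgue_modular p (ball_average r F) \<le> ball_const"
proof -
  define F1 where "F1 y = (if 1 < F y then F y else 0)" for y
  define F2 where "F2 y = (if 1 < F y then 0 else F y)" for y
  have [measurable]: "F1 \<in> borel_measurable borel" "F2 \<in> borel_measurable borel"
    unfolding F1_def F2_def by measurable
  have F_eq: "F = (\<lambda>y. F1 y + F2 y)" by (auto simp: F1_def F2_def)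
  have pw: "ennpowr (F1 y) (p y) \<le> ennpowr (F y) (p y)" "ennpowr (F2 y) (p y) \<le> ennpowr (F y) (p y)" for y
    by (auto simp: F1_def F2_def)
  have mod: "(\<integral>\<^sup>+ y. ennpowr (F1 y) (p y) \<partial>lborel) \<le> 1" "(\<integral>\<^sup>+ y. ennpowr (F2 y) (p y) \<partial>lborel) \<le> 1"
    using assms(2) nn_integral_mono[of lborel "\<lambda>y. ennpowr (F1 y) (p y)" "\<lambda>y. ennpowr (F y) (p y)"]
      nn_integral_mono[of lborel "\<lambda>y. ennpowr (F2 y) (p y)" "\<lambda>y. ennpowr (F y) (p y)"] pw
    by (auto simp: lebesgue_modular_def)
  have F1_le: "F1 y \<le> ennpowr (F1 y) (p y)" for y
    using ennpowr_mono_exponent[of "F1 y" 1 "p y"] p_ge_1[of y] by (auto simp: F1_def)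
  have mass: "(\<integral>\<^sup>+ y. F1 y \<partial>lborel) \<le> 1"
    by (rule order_trans[OF nn_integral_mono mod(1)]) (rule F1_le)
  have "lebesgue_modular p (ball_average r F1)
      \<le> (\<integral>\<^sup>+ x. ball_average r F1 x + ennreal osc_const * ball_average r (\<lambda>y. ennpowr (F1 y) (p y)) x \<partial>lborel)"
    unfolding lebesgue_modular_def
    by (intro nn_integral_mono ball_average_large_part r mass) (auto simp: F1_def)
  also have "\<dots> = (\<integral>\<^sup>+ y. F1 y \<partial>lborel) + ennreal osc_const * (\<integral>\<^sup>+ y. ennpowr (F1 y) (p y) \<partial>lborel)"
    by (simp add: nn_integral_add nn_integral_cmult nn_integral_ball_average r)
  also have "\<dots> \<le> 1 + ennreal osc_const * 1"
    by (intro add_mono mult_left_mono mass mod) simp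
  finally have large: "lebesgue_modular p (ball_average r F1) \<le> 1 + ennreal osc_const" by simp
  let ?g = "\<lambda>y::'a. ennreal (exp (- (norm y)\<^sup>2))"
  have "lebesgue_modular p (ball_average r F2)
      \<le> (\<integral>\<^sup>+ x. ennreal (exp C\<^sub>1) * ball_average r (\<lambda>y. ennreal (exp C\<^sub>1) * ennpowr (F2 y) (p y) + ?g y) x + ?g x \<partial>lborel)"
    unfolding lebesgue_modular_def
    by (intro nn_integral_mono ball_average_small_part r) (auto simp: F2_def)
  also have "\<dots> = ennreal (exp C\<^sub>1) * (ennreal (exp C\<^sub>1) * (\<integral>\<^sup>+ y. ennpowr (F2 y) (p y) \<partial>lborel) + gauss_mass) + gauss_mass"
    by (simp add: nn_integral_add nn_integral_cmult nn_integral_ball_average r gauss_mass_def)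
  also have "\<dots> \<le> ennreal (exp C\<^sub>1) * (ennreal (exp C\<^sub>1) * 1 + gauss_mass) + gauss_mass"
    by (intro add_mono mult_left_mono mod order_refl) simp_all
  finally have small: "lebesgue_modular p (ball_average r F2)
      \<le> ennreal (exp C\<^sub>1) * (ennreal (exp C\<^sub>1) + gauss_mass) + gauss_mass" by simp
  have "lebesgue_modular p (ball_average r F)
      = lebesgue_modular p (\<lambda>x. ball_average r F1 x + ball_average r F2 x)"
    by (subst F_eq, rule arg_cong[where f = "lebesgue_modular p"], rule ext, rule ball_average_add) measurable
  also have "\<dots> \<le> ennreal (2 powr P) * (lebesgue_modular p (ball_average r F1) + lebesgue_modular p (ball_average r F2))"
    by (intro lebesgue_modular_add p_ge_1 p_le) measurable
  also have "\<dots> \<le> ball_const"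
    unfolding ball_const_def by (intro mult_left_mono add_mono large small) simp
  finally show ?thesis .
qed

end

section \<open>Gaussian averages and their mixtures\<close>

definition gauss_average :: "real \<Rightarrow> real \<Rightarrow> ('a::euclidean_space \<Rightarrow> ennreal) \<Rightarrow> 'a \<Rightarrow> ennreal"
  where "gauss_average k \<sigma> F x =
    (\<integral>\<^sup>+ y. ennreal (exp (- (k * (norm (x - y) / \<sigma>)\<^sup>2)) / \<sigma> ^ DIM('a)) * F y \<partial>lborel)"

lemma measurable_gauss_average [measurable]:
  fixes F :: "'a::euclidean_space \<Rightarrow> ennreal"
  assumes [measurable]: "F \<in> borel_measurable borel" "f \<in> borel_measurable M" "\<rho> \<in> borel_measurable M"
  shows "(\<lambda>z. gauss_average k (\<rho> z) F (f z)) \<in> borel_measurable M"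
  unfolding gauss_average_def by measurable

text \<open>The distribution of the ratio between the radius of a ball and the width of the Gaussian in the superposition
below.\<close>

definition tail_measure :: "real measure"
  where "tail_measure = density lborel (\<lambda>z. ennreal (1 / z\<^sup>2) * indicator {1..} z)"

lemma sets_tail_measure [measurable_cong, simp]: "sets tail_measure = sets borel"
  by (simp add: tail_measure_def)

lemma emeasure_tail_measure: "emeasure tail_measure (space tail_measure) = 1"
  using nn_integral_power_tail[of 1 1]
  by (simp add: tail_measure_def emeasure_density power2_eq_square)

lemma sigma_finite_tail_measure: "sigma_finite_measure tail_measure"
  by (rule finite_measure.axioms(1)[OF finite_measureI]) (simp add: emeasure_tail_measure)

definition gauss_ball_const :: "real \<Rightarrow> 'a::euclidean_space itself \<Rightarrow> real"
  where "gauss_ball_const k _ = unit_ball_vol DIM('a) * (Suc DIM('a) * (1 + (Suc DIM('a) / k) ^ Suc DIM('a)))"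

text \<open>The layer-cake bound for exponent \<open>DIM('a) + 1\<close>, with the factor \<open>z ^ DIM('a)\<close> moved into the
normalisation of the ball of radius \<open>\<sigma> * z\<close>. The constant does not depend on \<open>\<sigma>\<close>.\<close>

lemma gauss_kernel_le_balls:
  fixes x y :: "'a::euclidean_space"
  assumes "0 < k" "0 < \<sigma>"
  shows "ennreal (exp (- (k * (norm (x - y) / \<sigma>)\<^sup>2)) / \<sigma> ^ DIM('a))
    \<le> ennreal (gauss_ball_const k TYPE('a)) * (\<integral>\<^sup>+ z. ennreal (1 / z\<^sup>2) * indicator {1..} z *
        (ennreal (1 / (unit_ball_vol DIM('a) * (\<sigma> * z) ^ DIM('a))) * indicator (ball x (\<sigma> * z)) y) \<partial>lborel)"
proof -
  let ?D = "DIM('a)" and ?v = "unit_ball_vol DIM('a)" and ?\<rho> = "norm (x - y) / \<sigma>"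
  let ?K = "Suc ?D * (1 + (Suc ?D / k) ^ Suc ?D)"
  have v: "0 < ?v" by simp
  have K: "0 \<le> ?K" using assms by simp
  have "ennreal (exp (- (k * ?\<rho>\<^sup>2)) / \<sigma> ^ ?D) = ennreal (1 / \<sigma> ^ ?D) * ennreal (exp (- (k * ?\<rho>\<^sup>2)))"
    using assms by (subst ennreal_mult[symmetric]) auto
  also have "\<dots> \<le> ennreal (1 / \<sigma> ^ ?D) * (ennreal ?K *
      (\<integral>\<^sup>+ z. ennreal (1 / z ^ Suc (Suc ?D)) * indicator {1..} z * indicator {?\<rho><..} z \<partial>lborel))"
    using assms by (intro mult_left_mono exp_neg_square_le_tail) auto
  also have "\<dots> = ennreal (1 / \<sigma> ^ ?D * ?K) *
      (\<integral>\<^sup>+ z. ennreal (1 / z ^ Suc (Suc ?D)) * indicator {1..} z * indicator {?\<rho><..} z \<partial>lborel)"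
    using assms K by (subst ennreal_mult) (auto simp: mult.assoc)
  also have "\<dots> = (\<integral>\<^sup>+ z. ennreal (1 / \<sigma> ^ ?D * ?K) *
      (ennreal (1 / z ^ Suc (Suc ?D)) * indicator {1..} z * indicator {?\<rho><..} z) \<partial>lborel)"
    by (intro nn_integral_cmult[symmetric]) measurable
  also have "\<dots> = (\<integral>\<^sup>+ z. ennreal (gauss_ball_const k TYPE('a)) * (ennreal (1 / z\<^sup>2) * indicator {1..} z *
        (ennreal (1 / (?v * (\<sigma> * z) ^ ?D)) * indicator (ball x (\<sigma> * z)) y)) \<partial>lborel)"
  proof (rule nn_integral_cong)
    fix z :: real
    show "ennreal (1 / \<sigma> ^ ?D * ?K) * (ennreal (1 / z ^ Suc (Suc ?D)) * indicator {1..} z * indicator {?\<rho><..} z)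
      = ennreal (gauss_ball_const k TYPE('a)) * (ennreal (1 / z\<^sup>2) * indicator {1..} z *
        (ennreal (1 / (?v * (\<sigma> * z) ^ ?D)) * indicator (ball x (\<sigma> * z)) y))"
    proof (cases "1 \<le> z \<and> ?\<rho> < z")
      case True
      have c: "gauss_ball_const k TYPE('a) = ?v * ?K" by (simp add: gauss_ball_const_def)
      have "ennreal (1 / \<sigma> ^ ?D * ?K) * ennreal (1 / z ^ Suc (Suc ?D))
          = ennreal (1 / \<sigma> ^ ?D * ?K * (1 / z ^ Suc (Suc ?D)))"
        using True assms K by (intro ennreal_mult[symmetric]) auto
      also have "1 / \<sigma> ^ ?D * ?K * (1 / z ^ Suc (Suc ?D)) = ?v * ?K * (1 / z\<^sup>2 * (1 / (?v * (\<sigma> * z) ^ ?D)))"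
        using True assms v by (simp add: power2_eq_square power_mult_distrib del: unit_ball_vol_pos)
      also have "ennreal \<dots> = ennreal (?v * ?K) * (ennreal (1 / z\<^sup>2) * ennreal (1 / (?v * (\<sigma> * z) ^ ?D)))"
        using True assms v K
        by (subst ennreal_mult[of "?v * ?K"], (simp; fail), (simp; fail), subst ennreal_mult[of "1 / z\<^sup>2"]) simp_all
      finally show ?thesis using True assms by (simp add: c dist_norm field_simps)
    next
      case False
      then show ?thesis using assms by (auto simp: indicator_def dist_norm field_simps)
    qed
  qed
  also have "\<dots> = ennreal (gauss_ball_const k TYPE('a)) * (\<integral>\<^sup>+ z. ennreal (1 / z\<^sup>2) * indicator {1..} z *
        (ennreal (1 / (?v * (\<sigma> * z) ^ ?D)) * indicator (ball x (\<sigma> * z)) y) \<partial>lborel)"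
    by (intro nn_integral_cmult) measurable
  finally show ?thesis .
qed

lemma gauss_average_le_balls:
  fixes F :: "'a::euclidean_space \<Rightarrow> ennreal"
  assumes [measurable]: "F \<in> borel_measurable borel" and "0 < k" "0 < \<sigma>"
  shows "gauss_average k \<sigma> F x
    \<le> ennreal (gauss_ball_const k TYPE('a)) * (\<integral>\<^sup>+ z. ball_average (\<sigma> * z) F x \<partial>tail_measure)"
proof -
  let ?D = "DIM('a)" and ?v = "unit_ball_vol DIM('a)" and ?c = "ennreal (gauss_ball_const k TYPE('a))"
  let ?w = "\<lambda>z y. ennreal (1 / z\<^sup>2) * indicator {1..} z *
      (ennreal (1 / (?v * (\<sigma> * z) ^ ?D)) * indicator (ball x (\<sigma> * z)) y)"
  have "gauss_average k \<sigma> F x \<le> (\<integral>\<^sup>+ y. ?c * (\<integral>\<^sup>+ z. ?w z y \<partial>lborel) * F y \<partial>lborel)"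
    unfolding gauss_average_def
    by (intro nn_integral_mono mult_right_mono gauss_kernel_le_balls assms) simp
  also have "\<dots> = ?c * (\<integral>\<^sup>+ y. (\<integral>\<^sup>+ z. ?w z y \<partial>lborel) * F y \<partial>lborel)"
    by (subst mult.assoc, rule nn_integral_cmult) measurable
  also have "(\<integral>\<^sup>+ y. (\<integral>\<^sup>+ z. ?w z y \<partial>lborel) * F y \<partial>lborel)
      = (\<integral>\<^sup>+ y. \<integral>\<^sup>+ z. ?w z y * F y \<partial>lborel \<partial>lborel)"
    by (intro nn_integral_cong nn_integral_multc[symmetric]) measurable
  also have "\<dots> = (\<integral>\<^sup>+ z. \<integral>\<^sup>+ y. ?w z y * F y \<partial>lborel \<partial>lborel)"
    by (rule lborel_pair.Fubini') measurable
  also have "\<dots> = (\<integral>\<^sup>+ z. ennreal (1 / z\<^sup>2) * indicator {1..} z * ball_average (\<sigma> * z) F x \<partial>lborel)"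
  proof (rule nn_integral_cong)
    fix z
    have "(\<integral>\<^sup>+ y. ?w z y * F y \<partial>lborel) = (\<integral>\<^sup>+ y. ennreal (1 / z\<^sup>2) * indicator {1..} z *
        (ennreal (1 / (?v * (\<sigma> * z) ^ ?D)) * (indicator (ball x (\<sigma> * z)) y * F y)) \<partial>lborel)"
      by (simp only: mult.assoc)
    also have "\<dots> = ennreal (1 / z\<^sup>2) * indicator {1..} z * ball_average (\<sigma> * z) F x"
      unfolding ball_average_def by (subst nn_integral_cmult, measurable)+
    finally show "(\<integral>\<^sup>+ y. ?w z y * F y \<partial>lborel)
        = ennreal (1 / z\<^sup>2) * indicator {1..} z * ball_average (\<sigma> * z) F x" .
  qed
  also have "\<dots> = (\<integral>\<^sup>+ z. ball_average (\<sigma> * z) F x \<partial>tail_measure)"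
    unfolding tail_measure_def by (intro nn_integral_density[symmetric]) measurable
  finally show ?thesis .
qed

text \<open>The gamma distribution. It absorbs the factor \<open>t powr (\<beta> / 2 - 1)\<close> of the Riesz potential together
with the decay \<open>exp (- t)\<close> of the semigroup on the complement of the constants.\<close>

definition gamma_measure :: "real \<Rightarrow> real measure"
  where "gamma_measure b = density lborel
    (\<lambda>t. ennreal (1 / Gamma b) * ennreal (indicator {0..} t * t powr (b - 1) / exp t))"

lemma sets_gamma_measure [measurable_cong, simp]: "sets (gamma_measure b) = sets borel"
  by (simp add: gamma_measure_def)

lemma emeasure_gamma_measure:
  assumes "0 < b"
  shows "emeasure (gamma_measure b) (space (gamma_measure b)) = 1"
proof -
  have "emeasure (gamma_measure b) (space (gamma_measure b)) = ennreal (1 / Gamma b) * ennreal (Gamma b)"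
    using assms by (simp add: gamma_measure_def emeasure_density nn_integral_cmult Gamma_conv_nn_integral_real)
  also have "\<dots> = 1"
    using Gamma_real_pos[OF assms] by (subst ennreal_mult[symmetric]) auto
  finally show ?thesis .
qed

lemma sigma_finite_gamma_measure: "0 < b \<Longrightarrow> sigma_finite_measure (gamma_measure b)"
  by (rule finite_measure.axioms(1)[OF finite_measureI]) (simp add: emeasure_gamma_measure)

lemma AE_gamma_measure_pos: "AE t in gamma_measure b. 0 < t"
proof -
  have "AE t in lborel. t \<noteq> (0::real)" by (rule AE_lborel_singleton)
  then show ?thesis
    unfolding gamma_measure_def by (subst AE_density) (auto elim!: eventually_mono simp: indicator_def split: if_splits)
qed

text \<open>The first summand captures the Mehler kernel up to time 1, the second the equilibrium kernel and all later
times.\<close>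

definition heat_average :: "real \<Rightarrow> real \<Rightarrow> ('a::euclidean_space \<Rightarrow> ennreal) \<Rightarrow> 'a \<Rightarrow> ennreal"
  where "heat_average k b F x =
    (\<integral>\<^sup>+ t. gauss_average k (min 1 (sqrt t)) F x + gauss_average k 1 F x \<partial>gamma_measure b)"

lemma measurable_heat_average [measurable]:
  assumes [measurable]: "F \<in> borel_measurable borel" and b: "0 < b"
  shows "heat_average k b F \<in> borel_measurable borel"
proof -
  interpret sigma_finite_measure "gamma_measure b" by (rule sigma_finite_gamma_measure[OF b])
  show ?thesis unfolding heat_average_def by measurable
qed

context log_hoelder_exponent
begin

definition gauss_const :: "real \<Rightarrow> ennreal"
  where "gauss_const k = ennreal (max 1 (gauss_ball_const k TYPE('a)) powr P) * ball_const"

lemma lebesgue_modular_gauss_average: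
  assumes F [measurable]: "F \<in> borel_measurable borel" and mod: "lebesgue_modular p F \<le> 1"
    and pos: "0 < k" "0 < \<sigma>"
  shows "lebesgue_modular p (gauss_average k \<sigma> F) \<le> gauss_const k"
proof -
  interpret T: sigma_finite_measure tail_measure by (rule sigma_finite_tail_measure)
  let ?c = "gauss_ball_const k TYPE('a)"
  have "lebesgue_modular p (gauss_average k \<sigma> F)
      \<le> lebesgue_modular p (\<lambda>x. ennreal (max 1 ?c) * (\<integral>\<^sup>+ z. ball_average (\<sigma> * z) F x \<partial>tail_measure))"
    by (intro lebesgue_modular_mono p_ge_1 order_trans[OF gauss_average_le_balls] F pos
        mult_right_mono ennreal_leI) simp_all
  also have "\<dots> \<le> ennreal (max 1 ?c powr P) * lebesgue_modular p (\<lambda>x. \<integral>\<^sup>+ z. ball_average (\<sigma> * z) F x \<partial>tail_measure)"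
  proof (rule lebesgue_modular_cmult)
    show "(\<lambda>x. \<integral>\<^sup>+ z. ball_average (\<sigma> * z) F x \<partial>tail_measure) \<in> borel_measurable borel"
      by measurable
  qed (simp_all add: p_ge_1 p_le)
  also have "lebesgue_modular p (\<lambda>x. \<integral>\<^sup>+ z. ball_average (\<sigma> * z) F x \<partial>tail_measure) \<le> ball_const"
  proof (rule lebesgue_modular_superposition)
    show "AE z in tail_measure. lebesgue_modular p (ball_average (\<sigma> * z) F) \<le> ball_const"
      unfolding tail_measure_def
      by (subst AE_density)
         (auto simp: indicator_def pos intro!: AE_I2 lebesgue_modular_ball_average F mod mult_pos_pos split: if_splits)
  qed (auto simp: emeasure_tail_measure p_ge_1 sigma_finite_tail_measure)
  finally show ?thesis by (simp add: gauss_const_def mult_left_mono)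
qed

definition heat_const :: "real \<Rightarrow> ennreal"
  where "heat_const k = ennreal (2 powr P) * (gauss_const k + gauss_const k)"

lemma heat_const_finite: "heat_const k < top"
  using ball_const_finite by (simp add: heat_const_def gauss_const_def ennreal_mult_less_top)

lemma lebesgue_modular_heat_average:
  assumes F [measurable]: "F \<in> borel_measurable borel" and mod: "lebesgue_modular p F \<le> 1"
    and pos: "0 < k" "0 < b"
  shows "lebesgue_modular p (heat_average k b F) \<le> heat_const k"
  unfolding heat_average_def
proof (rule lebesgue_modular_superposition)
  show "AE t in gamma_measure b.
      lebesgue_modular p (\<lambda>x. gauss_average k (min 1 (sqrt t)) F x + gauss_average k 1 F x) \<le> heat_const k"
    using AE_gamma_measure_pos
  proof eventually_elim
    case (elim t)
    have "lebesgue_modular p (\<lambda>x. gauss_average k (min 1 (sqrt t)) F x + gauss_average k 1 F x)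
        \<le> ennreal (2 powr P) * (lebesgue_modular p (gauss_average k (min 1 (sqrt t)) F)
            + lebesgue_modular p (gauss_average k 1 F))"
      by (intro lebesgue_modular_add p_ge_1 p_le) measurable
    also have "\<dots> \<le> heat_const k"
      unfolding heat_const_def using elim
      by (intro mult_left_mono add_mono lebesgue_modular_gauss_average F mod pos) auto
    finally show ?case .
  qed
qed (auto simp: emeasure_gamma_measure p_ge_1 sigma_finite_gamma_measure pos)

end

section \<open>The conjugated Mehler kernel\<close>

text \<open>The exponent of the Mehler kernel in the coordinates \<open>x + y\<close> and \<open>x - y\<close>, in which its symmetric
part is diagonal.\<close>

lemma mehler_exponent_identity:
  fixes x y :: "'a::real_inner"
  assumes "0 \<le> a" "a < 1" and \<tau>: "\<tau> = (1 - a) / (1 + a)"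
  shows "(norm (y - a *\<^sub>R x))\<^sup>2 / (1 - a\<^sup>2)
    = (\<tau> * (norm (x + y))\<^sup>2 + (norm (x - y))\<^sup>2 / \<tau>) / 4 + ((norm y)\<^sup>2 - (norm x)\<^sup>2) / 2"
proof -
  define A where "A = x \<bullet> x"
  define B where "B = y \<bullet> y"
  define C where "C = x \<bullet> y"
  have n: "(norm (y - a *\<^sub>R x))\<^sup>2 = B - 2 * a * C + a\<^sup>2 * A"
      "(norm (x + y))\<^sup>2 = A + B + 2 * C" "(norm (x - y))\<^sup>2 = A + B - 2 * C"
      "(norm x)\<^sup>2 = A" "(norm y)\<^sup>2 = B"
    unfolding A_def B_def C_def power2_norm_eq_inner
    by (simp_all add: inner_add inner_diff inner_commute[of y x] power2_eq_square)
       (simp_all add: algebra_simps)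
  have a: "1 - a > 0" "1 + a > 0" "1 - a\<^sup>2 = (1 - a) * (1 + a)"
    using assms by (auto simp: power2_eq_square algebra_simps)
  show ?thesis
    unfolding n \<tau> a(3) using a(1,2)
    by (simp add: divide_simps) (simp add: power2_eq_square algebra_simps)
qed

text \<open>With \<open>Q\<close> for the quadratic form on the right, the exponent equals \<open>(1 / 2 - \<theta>) * d - Q / 4\<close>, where
\<open>d = (norm x)\<^sup>2 - (norm y)\<^sup>2\<close> is the inner product of \<open>x + y\<close> and \<open>x - y\<close> and hence
\<open>\<bar>d\<bar> \<le> Q / 2\<close>. A negative multiple of \<open>Q\<close> remains precisely for \<open>0 < \<theta> < 1\<close>.\<close>

lemma conjugated_mehler_exponent_le:
  fixes x y :: "'a::real_inner"
  assumes "0 \<le> a" "a < 1" and \<tau>: "\<tau> = (1 - a) / (1 + a)"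
  shows "- \<theta> * (norm x)\<^sup>2 + \<theta> * (norm y)\<^sup>2 - (norm (y - a *\<^sub>R x))\<^sup>2 / (1 - a\<^sup>2)
    \<le> - (min \<theta> (1 - \<theta>) / 2) * (\<tau> * (norm (x + y))\<^sup>2 + (norm (x - y))\<^sup>2 / \<tau>)"
proof -
  define Q where "Q = \<tau> * (norm (x + y))\<^sup>2 + (norm (x - y))\<^sup>2 / \<tau>"
  define d where "d = (norm x)\<^sup>2 - (norm y)\<^sup>2"
  have t0: "0 < \<tau>" using assms by simp
  have am_gm: "u * w \<le> (u\<^sup>2 + w\<^sup>2) / 2" for u w :: real
    using sum_squares_bound[of u w] by simp
  have "d = (x + y) \<bullet> (x - y)"
    by (simp add: d_def power2_norm_eq_inner inner_add inner_diff inner_commute)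
  then have "\<bar>d\<bar> \<le> norm (x + y) * norm (x - y)" by (simp add: Cauchy_Schwarz_ineq2)
  also have "\<dots> = (sqrt \<tau> * norm (x + y)) * (norm (x - y) / sqrt \<tau>)" using t0 by simp
  also have "\<dots> \<le> ((sqrt \<tau> * norm (x + y))\<^sup>2 + (norm (x - y) / sqrt \<tau>)\<^sup>2) / 2"
    by (rule am_gm)
  also have "\<dots> = Q / 2" using t0 by (simp add: Q_def power_mult_distrib power_divide)
  finally have d: "\<bar>d\<bar> \<le> Q / 2" .
  have "(1 / 2 - \<theta>) * d \<le> \<bar>1 / 2 - \<theta>\<bar> * \<bar>d\<bar>"
    unfolding abs_mult[symmetric] by (rule abs_ge_self)
  also have "\<dots> \<le> \<bar>1 / 2 - \<theta>\<bar> * (Q / 2)"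
    by (intro mult_left_mono d) simp
  finally have 1: "(1 / 2 - \<theta>) * d \<le> \<bar>1 / 2 - \<theta>\<bar> * (Q / 2)" .
  have 2: "min \<theta> (1 - \<theta>) / 2 = 1 / 4 - \<bar>1 / 2 - \<theta>\<bar> / 2"
    by (cases "\<theta> \<le> 1 / 2") (auto simp: min_def field_simps)
  have "- \<theta> * (norm x)\<^sup>2 + \<theta> * (norm y)\<^sup>2 - (norm (y - a *\<^sub>R x))\<^sup>2 / (1 - a\<^sup>2)
      = (1 / 2 - \<theta>) * d - Q / 4"
    unfolding mehler_exponent_identity[OF assms] Q_def[symmetric] d_def
    by (simp add: left_diff_distrib right_diff_distrib diff_divide_distrib)
  also have "\<dots> \<le> \<bar>1 / 2 - \<theta>\<bar> * (Q / 2) - Q / 4" using 1 by simp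
  also have "\<dots> = - (min \<theta> (1 - \<theta>) / 2) * Q"
    unfolding 2 by (simp add: left_diff_distrib)
  finally show ?thesis unfolding Q_def .
qed

lemma abs_exp_diff_le:
  fixes u v :: real
  shows "\<bar>exp u - exp v\<bar> \<le> \<bar>u - v\<bar> * exp (max u v)"
proof -
  have *: "exp u - exp v \<le> (u - v) * exp u" for u v :: real
  proof -
    have "1 - exp (v - u) \<le> u - v" using exp_ge_add_one_self[of "v - u"] by linarith
    then have "(1 - exp (v - u)) * exp u \<le> (u - v) * exp u" by (intro mult_right_mono) auto
    then show ?thesis by (simp add: algebra_simps flip: exp_add)
  qed
  show ?thesis
    using *[of u v] *[of v u] by (cases "v \<le> u") (auto simp: max_def)
qed

text \<open>For \<open>\<theta> = 1 / q\<close> and \<open>\<delta>\<close> half the dimension, this is, up to the normalising factor,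
the modulus of the kernel of the semigroup minus the Gaussian mean, seen on the Lebesgue space.\<close>

definition conjugated_mehler :: "real \<Rightarrow> real \<Rightarrow> real \<Rightarrow> 'a::euclidean_space \<Rightarrow> 'a \<Rightarrow> real"
  where "conjugated_mehler \<theta> \<delta> t x y = exp (- \<theta> * (norm x)\<^sup>2) *
    \<bar>exp (- ((norm (y - exp (- t) *\<^sub>R x))\<^sup>2 / (1 - exp (- 2 * t)))) / (1 - exp (- 2 * t)) powr \<delta>
      - exp (- (norm y)\<^sup>2)\<bar> * exp (\<theta> * (norm y)\<^sup>2)"

definition mehler_const :: "real \<Rightarrow> real \<Rightarrow> real"
  where "mehler_const \<theta> \<delta> = exp 1 * (3 / 2) powr \<delta> * (1 + \<delta> + 12 / min \<theta> (1 - \<theta>))"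

lemma mehler_const_nonneg: "0 < \<theta> \<Longrightarrow> \<theta> < 1 \<Longrightarrow> 0 \<le> \<delta> \<Longrightarrow> 0 \<le> mehler_const \<theta> \<delta>"
  unfolding mehler_const_def by (intro mult_nonneg_nonneg add_nonneg_nonneg divide_nonneg_nonneg) auto

lemma conjugated_gauss_le:
  fixes x y :: "'a::euclidean_space"
  assumes \<theta>: "0 < \<theta>" "\<theta> < 1"
  shows "exp (- \<theta> * (norm x)\<^sup>2) * exp (- (norm y)\<^sup>2) * exp (\<theta> * (norm y)\<^sup>2)
    \<le> exp (- min \<theta> (1 - \<theta>) * ((norm x)\<^sup>2 + (norm y)\<^sup>2))"
proof -
  have "min \<theta> (1 - \<theta>) * (norm x)\<^sup>2 \<le> \<theta> * (norm x)\<^sup>2" "min \<theta> (1 - \<theta>) * (norm y)\<^sup>2 \<le> (1 - \<theta>) * (norm y)\<^sup>2"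
    by (intro mult_right_mono; simp)+
  then show ?thesis by (simp add: algebra_simps flip: exp_add)
qed

lemma norm_diff_square_le:
  fixes x y :: "'a::real_inner"
  shows "(norm (x - y))\<^sup>2 \<le> 2 * ((norm x)\<^sup>2 + (norm y)\<^sup>2)"
proof -
  have "(norm (x - y))\<^sup>2 + (norm (x + y))\<^sup>2 = 2 * ((norm x)\<^sup>2 + (norm y)\<^sup>2)"
    by (simp add: power2_norm_eq_inner inner_add inner_diff inner_commute)
  then show ?thesis by (metis add_le_same_cancel1 le_add_same_cancel1 zero_le_power2)
qed

text \<open>No cancellation is needed up to time 1, so the two terms of the kernel are bounded separately. Here
\<open>\<tau> \<le> t\<close>, which gives the width \<open>sqrt t\<close>, and \<open>1 - exp (- 2 * t)\<close> is comparable to \<open>t\<close>.\<close>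

lemma conjugated_mehler_small_time:
  fixes x y :: "'a::euclidean_space"
  assumes \<theta>: "0 < \<theta>" "\<theta> < 1" and \<delta>: "0 \<le> \<delta>" and t: "0 < t" "t \<le> 1"
    and k: "k = min \<theta> (1 - \<theta>) / 12"
  shows "conjugated_mehler \<theta> \<delta> t x y
    \<le> (3 / 2) powr \<delta> * (exp (- (k * ((norm (x - y))\<^sup>2 / t))) / t powr \<delta> + exp (- (k * (norm (x - y))\<^sup>2)))"
proof -
  define a where "a = exp (- t)"
  define \<tau> where "\<tau> = (1 - a) / (1 + a)"
  define v where "v = (norm (x - y))\<^sup>2"
  have a: "0 < a" "a < 1" "1 - exp (- 2 * t) = 1 - a\<^sup>2" using t by (auto simp: a_def power2_eq_square simp flip: exp_add)
  have \<tau>0: "0 < \<tau>" using a by (simp add: \<tau>_def)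
  have k0: "0 < k" "k \<le> min \<theta> (1 - \<theta>) / 2" "2 * k \<le> min \<theta> (1 - \<theta>)" using \<theta> by (auto simp: k)
  have "\<tau> \<le> 1 - a" using a by (simp add: \<tau>_def divide_le_eq)
  also have "\<dots> \<le> t" using exp_ge_add_one_self[of "- t"] by (simp add: a_def)
  finally have \<tau>t: "\<tau> \<le> t" .
  have v0: "0 \<le> v" by (simp add: v_def)
  have "k * (v / t) \<le> k * (v / \<tau>)"
    using \<tau>t \<tau>0 k0 v0 by (intro mult_left_mono divide_left_mono) auto
  also have "\<dots> \<le> k * (\<tau> * (norm (x + y))\<^sup>2 + v / \<tau>)"
    using \<tau>0 k0 by (intro mult_left_mono) auto
  also have "\<dots> \<le> (min \<theta> (1 - \<theta>) / 2) * (\<tau> * (norm (x + y))\<^sup>2 + v / \<tau>)"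
    using \<tau>0 k0 v0 by (intro mult_right_mono) auto
  finally have kv: "k * (v / t) \<le> (min \<theta> (1 - \<theta>) / 2) * (\<tau> * (norm (x + y))\<^sup>2 + v / \<tau>)" .
  have "- \<theta> * (norm x)\<^sup>2 + \<theta> * (norm y)\<^sup>2 - (norm (y - a *\<^sub>R x))\<^sup>2 / (1 - a\<^sup>2)
      \<le> - (min \<theta> (1 - \<theta>) / 2) * (\<tau> * (norm (x + y))\<^sup>2 + v / \<tau>)"
    unfolding v_def by (rule conjugated_mehler_exponent_le[OF less_imp_le[OF a(1)] a(2) \<tau>_def])
  also have "\<dots> \<le> - (k * (v / t))"
    unfolding minus_mult_left[symmetric] by (rule le_imp_neg_le[OF kv])
  finally have "- \<theta> * (norm x)\<^sup>2 + \<theta> * (norm y)\<^sup>2 - (norm (y - a *\<^sub>R x))\<^sup>2 / (1 - a\<^sup>2) \<le> - (k * (v / t))" .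
  then have 1: "exp (- \<theta> * (norm x)\<^sup>2) * exp (- ((norm (y - a *\<^sub>R x))\<^sup>2 / (1 - a\<^sup>2))) * exp (\<theta> * (norm y)\<^sup>2)
      \<le> exp (- (k * (v / t)))"
    by (simp flip: exp_add)
  have "1 + 2 * t \<le> exp (2 * t)" using exp_ge_add_one_self[of "2 * t"] by simp
  then have "exp (- 2 * t) \<le> 1 / (1 + 2 * t)"
    using t by (simp add: exp_minus inverse_eq_divide frac_le)
  also have "\<dots> \<le> 1 - 2 * t / 3"
  proof -
    have "0 \<le> t * (1 - t)" using t by simp
    moreover have "(1 - 2 * t / 3) * (1 + 2 * t) = 1 + 4 / 3 * (t * (1 - t))"
      by (simp add: field_simps)
    ultimately have "1 \<le> (1 - 2 * t / 3) * (1 + 2 * t)" by linarith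
    then show ?thesis using t by (subst pos_divide_le_eq) auto
  qed
  finally have s: "2 * t / 3 \<le> 1 - a\<^sup>2" using a by simp
  then have "(2 * t / 3) powr \<delta> \<le> (1 - a\<^sup>2) powr \<delta>" using t \<delta> by (intro powr_mono2) auto
  then have "1 / (1 - a\<^sup>2) powr \<delta> \<le> 1 / (2 * t / 3) powr \<delta>"
    using t s by (intro divide_left_mono) auto
  also have "\<dots> = (3 / 2) powr \<delta> / t powr \<delta>"
    using t by (simp add: powr_divide powr_mult field_simps)
  finally have 2: "1 / (1 - a\<^sup>2) powr \<delta> \<le> (3 / 2) powr \<delta> / t powr \<delta>" .
  have "exp (- \<theta> * (norm x)\<^sup>2) * exp (- (norm y)\<^sup>2) * exp (\<theta> * (norm y)\<^sup>2)
      \<le> exp (- min \<theta> (1 - \<theta>) * ((norm x)\<^sup>2 + (norm y)\<^sup>2))"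
    by (rule conjugated_gauss_le[OF \<theta>])
  also have "\<dots> \<le> exp (- (k * v))"
  proof -
    have "k * v \<le> k * (2 * ((norm x)\<^sup>2 + (norm y)\<^sup>2))"
      using k0 norm_diff_square_le[of x y] by (intro mult_left_mono) (auto simp: v_def)
    also have "\<dots> \<le> min \<theta> (1 - \<theta>) * ((norm x)\<^sup>2 + (norm y)\<^sup>2)"
      using mult_right_mono[OF k0(3), of "(norm x)\<^sup>2 + (norm y)\<^sup>2"] by (simp add: mult_ac)
    finally show ?thesis by simp
  qed
  finally have 3: "exp (- \<theta> * (norm x)\<^sup>2) * exp (- (norm y)\<^sup>2) * exp (\<theta> * (norm y)\<^sup>2) \<le> exp (- (k * v))" .
  have "conjugated_mehler \<theta> \<delta> t x y
      \<le> exp (- \<theta> * (norm x)\<^sup>2) * (exp (- ((norm (y - a *\<^sub>R x))\<^sup>2 / (1 - a\<^sup>2))) / (1 - a\<^sup>2) powr \<delta> + exp (- (norm y)\<^sup>2))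
        * exp (\<theta> * (norm y)\<^sup>2)"
    unfolding conjugated_mehler_def a(3) a_def[symmetric]
    by (intro mult_right_mono mult_left_mono order_trans[OF abs_triangle_ineq4]) auto
  also have "\<dots> = (exp (- \<theta> * (norm x)\<^sup>2) * exp (- ((norm (y - a *\<^sub>R x))\<^sup>2 / (1 - a\<^sup>2))) * exp (\<theta> * (norm y)\<^sup>2))
        * (1 / (1 - a\<^sup>2) powr \<delta>) + exp (- \<theta> * (norm x)\<^sup>2) * exp (- (norm y)\<^sup>2) * exp (\<theta> * (norm y)\<^sup>2)"
    by (simp add: algebra_simps)
  also have "\<dots> \<le> exp (- (k * (v / t))) * ((3 / 2) powr \<delta> / t powr \<delta>) + exp (- (k * v))"
    by (intro add_mono mult_mono 1 2 3) auto
  also have "\<dots> \<le> exp (- (k * (v / t))) * ((3 / 2) powr \<delta> / t powr \<delta>) + (3 / 2) powr \<delta> * exp (- (k * v))"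
    using \<delta> ge_one_powr_ge_zero[of "3 / 2" \<delta>] by simp
  also have "\<dots> = (3 / 2) powr \<delta> * (exp (- (k * (v / t))) / t powr \<delta> + exp (- (k * v)))"
    by (simp add: algebra_simps)
  finally show ?thesis by (simp add: v_def)
qed

text \<open>At \<open>a = 0\<close> the exponent of the Mehler kernel is that of the equilibrium kernel; the deviation is of first
order in \<open>a\<close>, which is what yields exponential decay in time for \<open>a = exp (- t)\<close>.\<close>

lemma mehler_exponent_increment:
  fixes x y :: "'a::euclidean_space"
  assumes a: "0 \<le> a" "a \<le> 1 / 2"
  shows "\<bar>(norm (y - a *\<^sub>R x))\<^sup>2 / (1 - a\<^sup>2) - (norm y)\<^sup>2\<bar> \<le> 2 * a * ((norm x)\<^sup>2 + (norm y)\<^sup>2)"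
proof -
  let ?R = "(norm x)\<^sup>2 + (norm y)\<^sup>2"
  have a2: "0 < 1 - a" "0 < 1 - a\<^sup>2" "1 - a\<^sup>2 = (1 - a) * (1 + a)"
    using a power_mono[of a "1 / 2" 2] by (auto simp: power2_eq_square algebra_simps)
  have n: "(norm (y - a *\<^sub>R x))\<^sup>2 = (norm y)\<^sup>2 - 2 * a * (x \<bullet> y) + a\<^sup>2 * (norm x)\<^sup>2"
    unfolding power2_norm_eq_inner
    by (simp add: inner_diff inner_commute[of y x] power2_eq_square) (simp add: algebra_simps)
  have eq: "(norm (y - a *\<^sub>R x))\<^sup>2 / (1 - a\<^sup>2) - (norm y)\<^sup>2 = (a\<^sup>2 * ?R - 2 * a * (x \<bullet> y)) / (1 - a\<^sup>2)"
    using a2(2) unfolding n by (simp add: field_simps)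
  have "\<bar>x \<bullet> y\<bar> \<le> norm x * norm y" by (rule Cauchy_Schwarz_ineq2)
  then have "2 * \<bar>x \<bullet> y\<bar> \<le> ?R" using sum_squares_bound[of "norm x" "norm y"] by linarith
  then have xy: "a * (2 * \<bar>x \<bullet> y\<bar>) \<le> a * ?R" using a by (intro mult_left_mono) auto
  have "\<bar>a\<^sup>2 * ?R - 2 * a * (x \<bullet> y)\<bar> \<le> \<bar>a\<^sup>2 * ?R\<bar> + \<bar>2 * a * (x \<bullet> y)\<bar>"
    by (rule abs_triangle_ineq4)
  also have "\<dots> \<le> a\<^sup>2 * ?R + a * ?R" using a xy by (simp add: abs_mult)
  also have "\<dots> = a * (1 + a) * ?R" by (simp add: power2_eq_square algebra_simps)
  finally have "\<bar>a\<^sup>2 * ?R - 2 * a * (x \<bullet> y)\<bar> / (1 - a\<^sup>2) \<le> a * (1 + a) * ?R / (1 - a\<^sup>2)"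
    using a2 by (intro divide_right_mono) auto
  also have "\<dots> = a * ?R / (1 - a)" using a2 a by (simp add: a2(3))
  also have "\<dots> \<le> a * ?R / (1 / 2)" using a by (intro divide_left_mono) auto
  also have "\<bar>a\<^sup>2 * ?R - 2 * a * (x \<bullet> y)\<bar> / (1 - a\<^sup>2)
      = \<bar>(norm (y - a *\<^sub>R x))\<^sup>2 / (1 - a\<^sup>2) - (norm y)\<^sup>2\<bar>"
    unfolding eq abs_divide abs_of_pos[OF a2(2)] ..
  finally show ?thesis by simp
qed

text \<open>Write the conjugated kernels as \<open>exp A\<close> and \<open>exp B\<close>. Both exponents are at most a constant minus a
multiple of \<open>R = (norm x)\<^sup>2 + (norm y)\<^sup>2\<close>, since \<open>\<tau>\<close> stays away from 0, and \<open>A - B\<close> is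
\<open>O(exp (- t) * (1 + R))\<close>. Half of the decay in \<open>R\<close> absorbs the factor \<open>1 + R\<close>; the other half
controls \<open>norm (x - y)\<close>. The value of \<open>k\<close> comes from here: \<open>\<tau> \<ge> 1 / 3\<close> leaves
\<open>min \<theta> (1 - \<theta>) / 3\<close> as the rate in \<open>R\<close>, halving gives a sixth, and \<open>(norm (x - y))\<^sup>2 \<le> 2 * R\<close>
a twelfth.\<close>

lemma conjugated_mehler_large_time:
  fixes x y :: "'a::euclidean_space"
  assumes \<theta>: "0 < \<theta>" "\<theta> < 1" and \<delta>: "0 \<le> \<delta>" and t: "1 \<le> t"
    and k: "k = min \<theta> (1 - \<theta>) / 12"
  shows "conjugated_mehler \<theta> \<delta> t x y
    \<le> (3 / 2) powr \<delta> * (\<delta> + 12 / min \<theta> (1 - \<theta>)) * exp (- t) * exp (- (k * (norm (x - y))\<^sup>2))"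
proof -
  define m where "m = min \<theta> (1 - \<theta>) / 2"
  define a where "a = exp (- t)"
  define \<tau> where "\<tau> = (1 - a) / (1 + a)"
  define R where "R = (norm x)\<^sup>2 + (norm y)\<^sup>2"
  define A where "A = - \<theta> * (norm x)\<^sup>2 + \<theta> * (norm y)\<^sup>2 - (norm (y - a *\<^sub>R x))\<^sup>2 / (1 - a\<^sup>2) - \<delta> * ln (1 - a\<^sup>2)"
  define B where "B = - \<theta> * (norm x)\<^sup>2 + \<theta> * (norm y)\<^sup>2 - (norm y)\<^sup>2"
  have m0: "0 < m" using \<theta> by (simp add: m_def)
  have m\<theta>: "m \<le> \<theta>" "m \<le> 1 - \<theta>"
    using \<theta> min.cobounded1[of \<theta> "1 - \<theta>"] min.cobounded2[of \<theta> "1 - \<theta>"] by (auto simp: m_def)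
  have R0: "0 \<le> R" by (simp add: R_def)
  have "2 \<le> exp (1::real)" using exp_ge_add_one_self[of 1] by simp
  also have "\<dots> \<le> exp t" using t by simp
  finally have ah: "0 < a" "a \<le> 1 / 2" by (simp_all add: a_def exp_minus inverse_eq_divide field_simps)
  have a2: "a\<^sup>2 \<le> 1 / 4" "a\<^sup>2 \<le> a / 2" using ah power_mono[of a "1 / 2" 2] by (auto simp: power2_eq_square)
  have a3: "1 - exp (- 2 * t) = 1 - a\<^sup>2" by (auto simp: a_def power2_eq_square simp flip: exp_add)
  have ln1: "ln (1 - a\<^sup>2) \<le> 0" using a2 ah by (simp add: ln_le_zero_iff)
  have "ln (1 / (1 - a\<^sup>2)) \<le> 1 / (1 - a\<^sup>2) - 1" using a2 by (intro ln_le_minus_one) auto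
  also have "\<dots> = a\<^sup>2 / (1 - a\<^sup>2)" using a2 by (simp add: field_simps)
  also have "\<dots> \<le> a\<^sup>2 / (1 / 2)" using a2 by (intro divide_left_mono) auto
  also have "\<dots> \<le> a" using a2 by simp
  finally have ln2: "- ln (1 - a\<^sup>2) \<le> a" using a2 by (simp add: ln_div)
  have AB: "\<bar>A - B\<bar> \<le> a * (2 * R + \<delta>)"
  proof -
    have "\<bar>A - B\<bar> \<le> \<bar>(norm (y - a *\<^sub>R x))\<^sup>2 / (1 - a\<^sup>2) - (norm y)\<^sup>2\<bar> + \<bar>\<delta> * ln (1 - a\<^sup>2)\<bar>"
      by (simp add: A_def B_def)
    also have "\<dots> \<le> 2 * a * R + \<delta> * a"
      using mehler_exponent_increment[of a y x] ah ln1 ln2 \<delta>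
        mult_left_mono[OF ln2 \<delta>]
      by (intro add_mono) (auto simp: R_def abs_mult)
    finally show ?thesis by (simp add: algebra_simps)
  qed
  have \<tau>: "1 / 3 \<le> \<tau>" "\<tau> \<le> 1" using ah by (auto simp: \<tau>_def field_simps)
  have "(norm (x - y))\<^sup>2 * (1 / 3) \<le> (norm (x - y))\<^sup>2 / \<tau>"
  proof -
    have "(norm (x - y))\<^sup>2 / 1 \<le> (norm (x - y))\<^sup>2 / \<tau>"
      using \<tau> by (intro divide_left_mono) auto
    then show ?thesis using zero_le_power2[of "norm (x - y)"] by linarith
  qed
  moreover have "(norm (x + y))\<^sup>2 * (1 / 3) \<le> \<tau> * (norm (x + y))\<^sup>2"
    using mult_right_mono[OF \<tau>(1), of "(norm (x + y))\<^sup>2"] by (simp add: mult_ac)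
  moreover have "(norm (x - y))\<^sup>2 + (norm (x + y))\<^sup>2 = 2 * R"
    by (simp add: R_def power2_norm_eq_inner inner_add inner_diff inner_commute)
  ultimately have "2 / 3 * R \<le> \<tau> * (norm (x + y))\<^sup>2 + (norm (x - y))\<^sup>2 / \<tau>" by linarith
  then have "m * (2 / 3 * R) \<le> m * (\<tau> * (norm (x + y))\<^sup>2 + (norm (x - y))\<^sup>2 / \<tau>)"
    using m0 by (intro mult_left_mono) auto
  moreover have "- \<theta> * (norm x)\<^sup>2 + \<theta> * (norm y)\<^sup>2 - (norm (y - a *\<^sub>R x))\<^sup>2 / (1 - a\<^sup>2)
      \<le> - m * (\<tau> * (norm (x + y))\<^sup>2 + (norm (x - y))\<^sup>2 / \<tau>)"
    unfolding m_def using ah by (intro conjugated_mehler_exponent_le \<tau>_def) auto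
  ultimately have "A \<le> - (2 / 3 * m * R) - \<delta> * ln (1 - a\<^sup>2)"
    unfolding A_def by (simp only: mult_minus_left mult.assoc mult.left_commute[of m])
  moreover have "- \<delta> * ln (1 - a\<^sup>2) \<le> \<delta> * ln (3 / 2)"
  proof -
    have "- ln (1 - a\<^sup>2) = ln (1 / (1 - a\<^sup>2))" using a2 by (simp add: ln_div)
    also have "\<dots> \<le> ln (3 / 2)" using a2 by (subst ln_le_cancel_iff) (auto simp: field_simps)
    finally show ?thesis using mult_left_mono[OF _ \<delta>] by fastforce
  qed
  ultimately have A: "A \<le> \<delta> * ln (3 / 2) - 2 / 3 * m * R" by simp
  have "m * (norm x)\<^sup>2 \<le> \<theta> * (norm x)\<^sup>2" "m * (norm y)\<^sup>2 \<le> (1 - \<theta>) * (norm y)\<^sup>2"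
    using m\<theta> by (auto intro: mult_right_mono)
  then have "B \<le> - (m * R)" by (simp add: B_def R_def algebra_simps)
  also have "\<dots> \<le> \<delta> * ln (3 / 2) - 2 / 3 * m * R"
  proof -
    have "0 \<le> m * R" "0 \<le> \<delta> * ln (3 / 2)" using m0 R0 \<delta> by simp_all
    then show ?thesis by linarith
  qed
  finally have B: "B \<le> \<delta> * ln (3 / 2) - 2 / 3 * m * R" .
  have e1: "1 - a\<^sup>2 > 0" using a2 by simp
  have "conjugated_mehler \<theta> \<delta> t x y = \<bar>exp A - exp B\<bar>"
  proof -
    have "conjugated_mehler \<theta> \<delta> t x y = \<bar>exp (- \<theta> * (norm x)\<^sup>2) *
      (exp (- ((norm (y - a *\<^sub>R x))\<^sup>2 / (1 - a\<^sup>2))) / (1 - a\<^sup>2) powr \<delta> - exp (- (norm y)\<^sup>2)) * exp (\<theta> * (norm y)\<^sup>2)\<bar>"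
      unfolding conjugated_mehler_def a3 a_def[symmetric] by (simp add: abs_mult)
    also have "exp (- \<theta> * (norm x)\<^sup>2) *
      (exp (- ((norm (y - a *\<^sub>R x))\<^sup>2 / (1 - a\<^sup>2))) / (1 - a\<^sup>2) powr \<delta> - exp (- (norm y)\<^sup>2)) * exp (\<theta> * (norm y)\<^sup>2)
      = exp A - exp B"
    proof -
      have w: "1 / (1 - a\<^sup>2) powr \<delta> = exp (- \<delta> * ln (1 - a\<^sup>2))"
        using e1 by (simp add: powr_def exp_minus inverse_eq_divide)
      have "exp A = exp (- \<theta> * (norm x)\<^sup>2) *
          (exp (- ((norm (y - a *\<^sub>R x))\<^sup>2 / (1 - a\<^sup>2))) * (1 / (1 - a\<^sup>2) powr \<delta>)) * exp (\<theta> * (norm y)\<^sup>2)"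
        unfolding w A_def exp_add[symmetric] by (rule arg_cong[where f = exp]) simp
      moreover have "exp B = exp (- \<theta> * (norm x)\<^sup>2) * exp (- (norm y)\<^sup>2) * exp (\<theta> * (norm y)\<^sup>2)"
        unfolding B_def exp_add[symmetric] by (rule arg_cong[where f = exp]) simp
      ultimately show ?thesis by (simp only: left_diff_distrib right_diff_distrib times_divide_eq_right mult_1_right)
    qed
    finally show ?thesis .
  qed
  also have "\<dots> \<le> \<bar>A - B\<bar> * exp (max A B)" by (rule abs_exp_diff_le)
  also have "\<dots> \<le> a * (2 * R + \<delta>) * exp (\<delta> * ln (3 / 2) - 2 / 3 * m * R)"
    using A B AB ah R0 \<delta> by (intro mult_mono) auto
  also have "\<dots> = a * (3 / 2) powr \<delta> * (exp (- (m * R / 3)) * ((2 * R + \<delta>) * exp (- (m * R / 3))))"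
    by (simp add: powr_def algebra_simps flip: exp_add)
  also have "\<dots> \<le> a * (3 / 2) powr \<delta> * (exp (- (k * (norm (x - y))\<^sup>2)) * (6 / m + \<delta>))"
  proof (intro mult_left_mono mult_mono)
    have "k * (norm (x - y))\<^sup>2 \<le> k * (2 * R)"
      using \<theta> norm_diff_square_le[of x y] by (intro mult_left_mono) (auto simp: k R_def)
    then show "exp (- (m * R / 3)) \<le> exp (- (k * (norm (x - y))\<^sup>2))"
      by (simp add: k m_def mult_ac)
    have "m * R / 3 \<le> exp (m * R / 3)" using exp_ge_add_one_self[of "m * R / 3"] by linarith
    then have "2 * R \<le> 6 / m * exp (m * R / 3)" using m0 by (simp add: field_simps)
    moreover have "\<delta> * 1 \<le> \<delta> * exp (m * R / 3)" using m0 R0 \<delta> by (intro mult_left_mono) auto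
    ultimately have "2 * R + \<delta> \<le> (6 / m + \<delta>) * exp (m * R / 3)" by (simp add: algebra_simps)
    then have "(2 * R + \<delta>) * exp (- (m * R / 3)) \<le> (6 / m + \<delta>) * exp (m * R / 3) * exp (- (m * R / 3))"
      by (intro mult_right_mono) auto
    then show "(2 * R + \<delta>) * exp (- (m * R / 3)) \<le> 6 / m + \<delta>" by (simp add: mult.assoc flip: exp_add)
  qed (use ah R0 \<delta> in auto)
  finally show ?thesis by (simp add: a_def m_def mult_ac add_ac)
qed

text \<open>The two time ranges in one formula. For \<open>t \<le> 1\<close> the factor \<open>exp (- t)\<close> costs only the \<open>exp 1\<close> in
the constant; for \<open>t > 1\<close> the second Gaussian suffices.\<close>

lemma conjugated_mehler_le:
  fixes x y :: "'a::euclidean_space"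
  assumes \<theta>: "0 < \<theta>" "\<theta> < 1" and t: "0 < t" and k: "k = min \<theta> (1 - \<theta>) / 12"
  shows "conjugated_mehler \<theta> (n / 2) t x y \<le> mehler_const \<theta> (n / 2) * exp (- t) *
    (exp (- (k * (norm (x - y) / min 1 (sqrt t))\<^sup>2)) / min 1 (sqrt t) ^ n
      + exp (- (k * (norm (x - y) / 1)\<^sup>2)) / 1 ^ n)"
    (is "_ \<le> _ * (?g + ?h)")
proof -
  let ?\<delta> = "real n / 2"
  have pos: "0 < min \<theta> (1 - \<theta>)" using \<theta> by simp
  have gh: "0 \<le> ?g" "0 \<le> ?h" using t by auto
  show ?thesis
  proof (cases "t \<le> 1")
    case True
    have "conjugated_mehler \<theta> ?\<delta> t x y
      \<le> (3 / 2) powr ?\<delta> * (exp (- (k * ((norm (x - y))\<^sup>2 / t))) / t powr ?\<delta> + exp (- (k * (norm (x - y))\<^sup>2)))"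
      by (intro conjugated_mehler_small_time \<theta> t True k) simp
    also have "\<dots> = (3 / 2) powr ?\<delta> * (?g + ?h)"
    proof -
      have "min 1 (sqrt t) = sqrt t" using True by simp
      moreover have "t powr ?\<delta> = sqrt t ^ n"
        using t by (simp add: powr_half_sqrt[symmetric] powr_realpow[symmetric] powr_powr)
      ultimately show ?thesis using t by (simp add: power_divide)
    qed
    also have "(3 / 2) powr ?\<delta> \<le> mehler_const \<theta> ?\<delta> * exp (- t)"
    proof -
      have "1 * 1 \<le> (exp 1 * exp (- t)) * (1 + ?\<delta> + 12 / min \<theta> (1 - \<theta>))"
        using True pos by (intro mult_mono) (auto simp flip: exp_add)
      then have "(3 / 2) powr ?\<delta> * 1 \<le> (3 / 2) powr ?\<delta> * ((exp 1 * exp (- t)) * (1 + ?\<delta> + 12 / min \<theta> (1 - \<theta>)))"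
        by (intro mult_left_mono) auto
      then show ?thesis by (simp add: mehler_const_def mult_ac)
    qed
    finally show ?thesis using gh by (simp add: mult_right_mono)
  next
    case False
    have "conjugated_mehler \<theta> ?\<delta> t x y
      \<le> (3 / 2) powr ?\<delta> * (?\<delta> + 12 / min \<theta> (1 - \<theta>)) * exp (- t) * exp (- (k * (norm (x - y))\<^sup>2))"
      using False by (intro conjugated_mehler_large_time \<theta> k) auto
    also have "\<dots> = (3 / 2) powr ?\<delta> * (?\<delta> + 12 / min \<theta> (1 - \<theta>)) * exp (- t) * ?h" by simp
    also have "\<dots> \<le> mehler_const \<theta> ?\<delta> * exp (- t) * (?g + ?h)"
    proof (intro mult_mono)
      have "1 * ((3 / 2) powr ?\<delta> * (?\<delta> + 12 / min \<theta> (1 - \<theta>))) \<le> exp 1 * ((3 / 2) powr ?\<delta> * (1 + ?\<delta> + 12 / min \<theta> (1 - \<theta>)))"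
        using pos by (intro mult_mono) auto
      then show "(3 / 2) powr ?\<delta> * (?\<delta> + 12 / min \<theta> (1 - \<theta>)) \<le> mehler_const \<theta> ?\<delta>"
        by (simp add: mehler_const_def mult_ac)
    qed (use gh pos mehler_const_nonneg[of \<theta> ?\<delta>] \<theta> in auto)
    finally show ?thesis .
  qed
qed

section \<open>The Riesz kernel\<close>

lemma ennreal_abs_integral_le:
  fixes f :: "'a \<Rightarrow> real"
  shows "ennreal \<bar>integral\<^sup>L M f\<bar> \<le> (\<integral>\<^sup>+ x. ennreal \<bar>f x\<bar> \<partial>M)"
proof (cases "integrable M f")
  case True
  then show ?thesis using integral_norm_bound_ennreal[of M f] by simp
qed (simp add: not_integrable_integral_eq)

lemma measurable_riesz_kernel [measurable]:
  "(\<lambda>z. riesz_kernel \<beta> (fst z) (snd z :: real ^ 'n::finite)) \<in> borel_measurable (borel \<Otimes>\<^sub>M borel)"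
  unfolding riesz_kernel_def set_lebesgue_integral_def by measurable

definition heat_kernel :: "real \<Rightarrow> real \<Rightarrow> 'a::euclidean_space \<Rightarrow> 'a \<Rightarrow> ennreal"
  where "heat_kernel k t x y =
    ennreal (exp (- (k * (norm (x - y) / min 1 (sqrt t))\<^sup>2)) / min 1 (sqrt t) ^ DIM('a))
    + ennreal (exp (- (k * (norm (x - y) / 1)\<^sup>2)) / 1 ^ DIM('a))"

lemma measurable_heat_kernel [measurable]:
  assumes [measurable]: "f \<in> borel_measurable M" "g \<in> borel_measurable M" "h \<in> borel_measurable M"
  shows "(\<lambda>z. heat_kernel k (f z) (g z) (h z :: 'a::euclidean_space)) \<in> borel_measurable M"
  unfolding heat_kernel_def by measurable

lemma heat_average_eq_kernel:
  fixes F :: "'a::euclidean_space \<Rightarrow> ennreal"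
  assumes [measurable]: "F \<in> borel_measurable borel" and b: "0 < b"
  shows "heat_average k b F x = (\<integral>\<^sup>+ y. (\<integral>\<^sup>+ t. heat_kernel k t x y \<partial>gamma_measure b) * F y \<partial>lborel)"
proof -
  interpret G: sigma_finite_measure "gamma_measure b" by (rule sigma_finite_gamma_measure[OF b])
  interpret pair_sigma_finite "gamma_measure b" "lborel :: 'a measure" ..
  have "heat_average k b F x = (\<integral>\<^sup>+ t. \<integral>\<^sup>+ y. heat_kernel k t x y * F y \<partial>lborel \<partial>gamma_measure b)"
    unfolding heat_average_def gauss_average_def heat_kernel_def distrib_right
    by (subst nn_integral_add) measurable
  also have "\<dots> = (\<integral>\<^sup>+ y. \<integral>\<^sup>+ t. heat_kernel k t x y * F y \<partial>gamma_measure b \<partial>lborel)"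
    by (rule Fubini'[symmetric]) measurable
  also have "\<dots> = (\<integral>\<^sup>+ y. (\<integral>\<^sup>+ t. heat_kernel k t x y \<partial>gamma_measure b) * F y \<partial>lborel)"
    by (intro nn_integral_cong nn_integral_multc) measurable
  finally show ?thesis .
qed

text \<open>Take absolute values under the time integral and insert the bound for the conjugated Mehler kernel;
\<open>t powr (\<beta> / 2 - 1) * exp (- t) / Gamma (\<beta> / 2)\<close> is the gamma density.\<close>

lemma riesz_kernel_le_heat_kernel:
  fixes x y :: "real ^ 'n::finite"
  assumes \<theta>: "0 < \<theta>" "\<theta> < 1" and \<beta>: "0 < \<beta>" and k: "k = min \<theta> (1 - \<theta>) / 12"
  shows "ennreal (exp (- \<theta> * (norm x)\<^sup>2) * \<bar>riesz_kernel \<beta> x y\<bar> * exp (\<theta> * (norm y)\<^sup>2))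
    \<le> ennreal (mehler_const \<theta> (CARD('n) / 2)) * (\<integral>\<^sup>+ t. heat_kernel k t x y \<partial>gamma_measure (\<beta> / 2))"
proof -
  let ?\<delta> = "real CARD('n) / 2" and ?b = "\<beta> / 2"
  let ?c = "1 / (pi powr ?\<delta> * Gamma ?b)" and ?K = "mehler_const \<theta> ?\<delta>"
  let ?m = "\<lambda>t. exp (- ((norm (y - exp (- t) *\<^sub>R x))\<^sup>2 / (1 - exp (- 2 * t)))) / (1 - exp (- 2 * t)) powr ?\<delta>
        - exp (- (norm y)\<^sup>2)"
  have G: "0 < Gamma ?b" using \<beta> by (intro Gamma_real_pos) simp
  \<comment> \<open>The factor \<open>1 / pi powr ?\<delta>\<close> of the Riesz kernel is at most 1.\<close>
  have pp: "1 \<le> pi powr ?\<delta>" using pi_gt3 by (intro ge_one_powr_ge_zero) auto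
  have c: "0 \<le> ?c" "?c \<le> 1 / Gamma ?b"
    using G pp by (auto simp: field_simps)
  have K: "0 \<le> ?K" using \<theta> by (intro mehler_const_nonneg) auto
  let ?e = "exp (- \<theta> * (norm x)\<^sup>2)" and ?f = "exp (\<theta> * (norm y)\<^sup>2)"
  have "\<bar>riesz_kernel \<beta> x y\<bar> = ?c * \<bar>LINT t:{0<..}|lborel. t powr (?b - 1) * ?m t\<bar>"
    unfolding riesz_kernel_def abs_mult abs_of_nonneg[OF c(1)] ..
  then have "?e * \<bar>riesz_kernel \<beta> x y\<bar> * ?f
      = (?e * ?c * ?f) * \<bar>LINT t:{0<..}|lborel. t powr (?b - 1) * ?m t\<bar>"
    by (simp only: mult_ac)
  then have "ennreal (?e * \<bar>riesz_kernel \<beta> x y\<bar> * ?f)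
      = ennreal (?e * ?c * ?f) * ennreal \<bar>LINT t:{0<..}|lborel. t powr (?b - 1) * ?m t\<bar>"
    using c(1) by (simp only: ennreal_mult abs_ge_zero mult_nonneg_nonneg exp_ge_zero)
  also have "\<dots> \<le> ennreal (?e * ?c * ?f) *
      (\<integral>\<^sup>+ t. ennreal \<bar>indicator {0<..} t *\<^sub>R (t powr (?b - 1) * ?m t)\<bar> \<partial>lborel)"
    unfolding set_lebesgue_integral_def by (intro mult_left_mono ennreal_abs_integral_le) simp
  also have "\<dots> = (\<integral>\<^sup>+ t. ennreal (?e * ?c * ?f) *
      ennreal \<bar>indicator {0<..} t *\<^sub>R (t powr (?b - 1) * ?m t)\<bar> \<partial>lborel)"
    by (intro nn_integral_cmult[symmetric]) measurable
  also have "\<dots> \<le> (\<integral>\<^sup>+ t. ennreal ?K * (ennreal (1 / Gamma ?b) * ennreal (indicator {0..} t * t powr (?b - 1) / exp t)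
      * heat_kernel k t x y) \<partial>lborel)"
  proof (intro nn_integral_mono)
    fix t :: real
    show "ennreal (?e * ?c * ?f) * ennreal \<bar>indicator {0<..} t *\<^sub>R (t powr (?b - 1) * ?m t)\<bar>
      \<le> ennreal ?K * (ennreal (1 / Gamma ?b) * ennreal (indicator {0..} t * t powr (?b - 1) / exp t)
      * heat_kernel k t x y)"
    proof (cases "0 < t")
      case True
      let ?g = "exp (- (k * (norm (x - y) / min 1 (sqrt t))\<^sup>2)) / min 1 (sqrt t) ^ CARD('n)
        + exp (- (k * (norm (x - y) / 1)\<^sup>2)) / 1 ^ CARD('n)"
      have g: "0 \<le> ?g" using True by simp
      have et: "exp (- t) = 1 / exp t" by (simp add: exp_minus inverse_eq_divide)
      have mult4: "ennreal (u * (v * w * z)) = ennreal u * (ennreal v * ennreal w * ennreal z)"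
        if "0 \<le> u" "0 \<le> v" "0 \<le> w" "0 \<le> z" for u v w z
        using that by (simp only: ennreal_mult mult_nonneg_nonneg)
      have hk: "heat_kernel k t x y = ennreal ?g"
        unfolding heat_kernel_def using True by (subst ennreal_plus) auto
      have "(?e * ?c * ?f) * (t powr (?b - 1) * \<bar>?m t\<bar>) = ?c * t powr (?b - 1) * conjugated_mehler \<theta> ?\<delta> t x y"
        by (simp add: conjugated_mehler_def mult_ac)
      also have "\<dots> \<le> 1 / Gamma ?b * t powr (?b - 1) * (?K * exp (- t) * ?g)"
      proof (rule mult_mono)
        show "?c * t powr (?b - 1) \<le> 1 / Gamma ?b * t powr (?b - 1)"
          by (intro mult_right_mono c) simp
        show "conjugated_mehler \<theta> ?\<delta> t x y \<le> ?K * exp (- t) * ?g"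
          by (intro conjugated_mehler_le \<theta> True k)
        show "0 \<le> 1 / Gamma ?b * t powr (?b - 1)" using G by simp
        show "0 \<le> conjugated_mehler \<theta> ?\<delta> t x y" by (simp add: conjugated_mehler_def)
      qed
      also have "\<dots> = ?K * (1 / Gamma ?b * (t powr (?b - 1) / exp t) * ?g)"
        unfolding et by (simp only: times_divide_eq_right times_divide_eq_left mult_1_right mult_1_left mult_ac)
      finally have "ennreal ((?e * ?c * ?f) * (t powr (?b - 1) * \<bar>?m t\<bar>))
          \<le> ennreal (?K * (1 / Gamma ?b * (t powr (?b - 1) / exp t) * ?g))"
        by (rule ennreal_leI)
      also have "\<dots> = ennreal ?K * (ennreal (1 / Gamma ?b) * ennreal (t powr (?b - 1) / exp t) * ennreal ?g)"
        by (rule mult4) (use K less_imp_le[OF G] g in simp_all)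
      also have "ennreal ((?e * ?c * ?f) * (t powr (?b - 1) * \<bar>?m t\<bar>))
          = ennreal (?e * ?c * ?f) * ennreal (t powr (?b - 1) * \<bar>?m t\<bar>)"
        by (rule ennreal_mult) (intro mult_nonneg_nonneg c(1) exp_ge_zero powr_ge_zero abs_ge_zero)+
      also have "t powr (?b - 1) * \<bar>?m t\<bar> = \<bar>indicator {0<..} t *\<^sub>R (t powr (?b - 1) * ?m t)\<bar>"
        using True by (simp add: abs_mult)
      also have "t powr (?b - 1) / exp t = indicator {0..} t * t powr (?b - 1) / exp t"
        using True by simp
      finally show ?thesis unfolding hk .
    qed simp
  qed
  also have "\<dots> = ennreal ?K * (\<integral>\<^sup>+ t. ennreal (1 / Gamma ?b) * ennreal (indicator {0..} t * t powr (?b - 1) / exp t)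
      * heat_kernel k t x y \<partial>lborel)"
    by (intro nn_integral_cmult) measurable
  also have "(\<integral>\<^sup>+ t. ennreal (1 / Gamma ?b) * ennreal (indicator {0..} t * t powr (?b - 1) / exp t)
      * heat_kernel k t x y \<partial>lborel) = (\<integral>\<^sup>+ t. heat_kernel k t x y \<partial>gamma_measure ?b)"
    unfolding gamma_measure_def by (intro nn_integral_density[symmetric]) measurable
  finally show ?thesis .
qed

text \<open>The operator with the absolute kernel. It controls the potential and its absolute convergence at the same
time.\<close>

definition abs_riesz :: "real \<Rightarrow> (real ^ 'n::finite \<Rightarrow> ennreal) \<Rightarrow> real ^ 'n \<Rightarrow> ennreal"
  where "abs_riesz \<beta> G x = (\<integral>\<^sup>+ y. ennreal \<bar>riesz_kernel \<beta> x y\<bar> * G y \<partial>lborel)"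

lemma measurable_abs_riesz [measurable]:
  assumes [measurable]: "G \<in> borel_measurable borel"
  shows "abs_riesz \<beta> G \<in> borel_measurable borel"
proof -
  have [measurable]: "(\<lambda>(x, y). riesz_kernel \<beta> x (y :: real ^ 'n)) \<in> borel_measurable (borel \<Otimes>\<^sub>M borel)"
    using measurable_riesz_kernel by (simp add: case_prod_beta')
  show ?thesis unfolding abs_riesz_def by measurable
qed

lemma abs_riesz_le_heat_average:
  fixes G :: "real ^ 'n::finite \<Rightarrow> ennreal"
  assumes [measurable]: "G \<in> borel_measurable borel"
    and \<theta>: "0 < \<theta>" "\<theta> < 1" and \<beta>: "0 < \<beta>" and k: "k = min \<theta> (1 - \<theta>) / 12"
  shows "abs_riesz \<beta> G x \<le> ennreal (mehler_const \<theta> (CARD('n) / 2)) * (ennreal (exp (\<theta> * (norm x)\<^sup>2)) *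
    heat_average k (\<beta> / 2) (\<lambda>y. ennreal (exp (- \<theta> * (norm y)\<^sup>2)) * G y) x)"
proof -
  let ?K = "ennreal (mehler_const \<theta> (CARD('n) / 2))" and ?E = "ennreal (exp (\<theta> * (norm x)\<^sup>2))"
  let ?h = "\<lambda>y. \<integral>\<^sup>+ t. heat_kernel k t x y \<partial>gamma_measure (\<beta> / 2)"
  interpret G: sigma_finite_measure "gamma_measure (\<beta> / 2)" using \<beta> by (intro sigma_finite_gamma_measure) simp
  have "abs_riesz \<beta> G x \<le> (\<integral>\<^sup>+ y. (?K * ?E) * (?h y * (ennreal (exp (- \<theta> * (norm y)\<^sup>2)) * G y)) \<partial>lborel)"
    unfolding abs_riesz_def
  proof (intro nn_integral_mono)
    fix y :: "real ^ 'n"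
    let ?e = "exp (- \<theta> * (norm x)\<^sup>2) * \<bar>riesz_kernel \<beta> x y\<bar> * exp (\<theta> * (norm y)\<^sup>2)"
    have "\<bar>riesz_kernel \<beta> x y\<bar> = exp (\<theta> * (norm x)\<^sup>2) * (?e * exp (- \<theta> * (norm y)\<^sup>2))"
    proof -
      have "exp (\<theta> * (norm x)\<^sup>2) * (?e * exp (- \<theta> * (norm y)\<^sup>2))
          = (exp (\<theta> * (norm x)\<^sup>2) * exp (- \<theta> * (norm x)\<^sup>2)) * \<bar>riesz_kernel \<beta> x y\<bar>
            * (exp (\<theta> * (norm y)\<^sup>2) * exp (- \<theta> * (norm y)\<^sup>2))"
        by (simp only: mult_ac)
      then show ?thesis unfolding exp_add[symmetric] by simp
    qed
    then have "ennreal \<bar>riesz_kernel \<beta> x y\<bar> = ennreal (exp (\<theta> * (norm x)\<^sup>2) * (?e * exp (- \<theta> * (norm y)\<^sup>2)))"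
      by (rule arg_cong)
    also have "\<dots> = ?E * (ennreal ?e * ennreal (exp (- \<theta> * (norm y)\<^sup>2)))"
      by (simp only: ennreal_mult mult_nonneg_nonneg exp_ge_zero abs_ge_zero)
    also have "\<dots> \<le> ?E * ((?K * ?h y) * ennreal (exp (- \<theta> * (norm y)\<^sup>2)))"
      by (intro mult_left_mono mult_right_mono riesz_kernel_le_heat_kernel \<theta> \<beta> k) simp_all
    finally have "ennreal \<bar>riesz_kernel \<beta> x y\<bar> * G y \<le> ?E * ((?K * ?h y) * ennreal (exp (- \<theta> * (norm y)\<^sup>2))) * G y"
      by (rule mult_right_mono) simp
    then show "ennreal \<bar>riesz_kernel \<beta> x y\<bar> * G y
        \<le> (?K * ?E) * (?h y * (ennreal (exp (- \<theta> * (norm y)\<^sup>2)) * G y))"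
      by (simp only: mult_ac)
  qed
  also have "\<dots> = (?K * ?E) * (\<integral>\<^sup>+ y. ?h y * (ennreal (exp (- \<theta> * (norm y)\<^sup>2)) * G y) \<partial>lborel)"
    by (intro nn_integral_cmult) measurable
  also have "\<dots> = (?K * ?E) * heat_average k (\<beta> / 2) (\<lambda>y. ennreal (exp (- \<theta> * (norm y)\<^sup>2)) * G y) x"
    using \<beta> by (subst heat_average_eq_kernel) auto
  finally show ?thesis by (simp add: mult.assoc)
qed

section \<open>From Lebesgue measure to Gaussian measure\<close>

definition gauss_density :: "real ^ 'n::finite \<Rightarrow> ennreal"
  where "gauss_density x = ennreal (pi powr (- (real CARD('n) / 2)) * exp (- (norm x)\<^sup>2))"

lemma measurable_gauss_density [measurable]: "gauss_density \<in> borel_measurable borel"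
  unfolding gauss_density_def by measurable

lemma heat_average_cmult:
  fixes F :: "'a::euclidean_space \<Rightarrow> ennreal"
  assumes [measurable]: "F \<in> borel_measurable borel" and b: "0 < b"
  shows "heat_average k b (\<lambda>y. c * F y) x = c * heat_average k b F x"
proof -
  interpret G: sigma_finite_measure "gamma_measure b" by (rule sigma_finite_gamma_measure[OF b])
  have "heat_average k b (\<lambda>y. c * F y) x = (\<integral>\<^sup>+ y. c * ((\<integral>\<^sup>+ t. heat_kernel k t x y \<partial>gamma_measure b) * F y) \<partial>lborel)"
    using b by (simp add: heat_average_eq_kernel mult_ac)
  also have "\<dots> = c * heat_average k b F x"
    using b by (subst nn_integral_cmult) (auto simp: heat_average_eq_kernel)
  finally show ?thesis .
qed

text \<open>Dividing out the Gaussian leaves, in both cases, the exponential of \<open>(p x - q) * (norm x)\<^sup>2 / q\<close> up to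
sign, and the decay of \<open>p\<close> bounds this exponent.\<close>

lemma (in log_hoelder_exponent) weight_compare:
  assumes q: "1 < q"
  shows "exp (- (norm x)\<^sup>2 / q) powr p x \<le> exp C\<^sub>1 * exp (- (norm x)\<^sup>2)"
    and "exp ((norm x)\<^sup>2 / q) powr p x * exp (- (norm x)\<^sup>2) \<le> exp C\<^sub>1"
proof -
  have "\<bar>(p x - q) * (norm x)\<^sup>2\<bar> \<le> C\<^sub>1" using decay[of x] by (simp add: abs_mult)
  moreover have "\<bar>(p x - q) * (norm x)\<^sup>2\<bar> / q \<le> \<bar>(p x - q) * (norm x)\<^sup>2\<bar> / 1"
    using q by (intro divide_left_mono) auto
  ultimately have "\<bar>(p x - q) * (norm x)\<^sup>2 / q\<bar> \<le> C\<^sub>1" using q by simp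
  moreover have "(p x - q) * (norm x)\<^sup>2 / q = (norm x)\<^sup>2 / q * p x - (norm x)\<^sup>2"
    using q by (simp add: field_simps)
  ultimately have *: "\<bar>(norm x)\<^sup>2 / q * p x - (norm x)\<^sup>2\<bar> \<le> C\<^sub>1" by simp
  show "exp (- (norm x)\<^sup>2 / q) powr p x \<le> exp C\<^sub>1 * exp (- (norm x)\<^sup>2)"
    using * by (simp add: exp_powr_real abs_le_iff flip: exp_add)
  show "exp ((norm x)\<^sup>2 / q) powr p x * exp (- (norm x)\<^sup>2) \<le> exp C\<^sub>1"
    using * by (simp add: exp_powr_real abs_le_iff flip: exp_add)
qed

definition gauss_modular :: "(real ^ 'n::finite \<Rightarrow> real) \<Rightarrow> (real ^ 'n \<Rightarrow> ennreal) \<Rightarrow> ennreal"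
  where "gauss_modular p G = (\<integral>\<^sup>+ x. ennpowr (G x) (p x) * gauss_density x \<partial>lborel)"

text \<open>Conjugation by \<open>exp (- (norm y)\<^sup>2 / q)\<close> transfers the bound for \<open>heat_average\<close>. The scalar \<open>c\<close>
makes the transferred function have Lebesgue modular at most 1; as \<open>heat_average\<close> is linear, it is undone
by the factor \<open>1 / c\<close>.\<close>

lemma gauss_modular_abs_riesz_bounded:
  fixes p :: "real ^ 'n::finite \<Rightarrow> real"
  assumes "log_hoelder_exponent p P q C\<^sub>0 C\<^sub>1" and q: "1 < q" and \<beta>: "0 < \<beta>"
  shows "\<exists>C::real. \<forall>G \<in> borel_measurable borel.
    gauss_modular p G \<le> 1 \<longrightarrow> gauss_modular p (abs_riesz \<beta> G) \<le> ennreal C"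
proof -
  interpret log_hoelder_exponent p P q C\<^sub>0 C\<^sub>1 by fact
  define \<theta> where "\<theta> = 1 / q"
  define k where "k = min \<theta> (1 - \<theta>) / 12"
  define c where "c = pi powr (- (real CARD('n) / 2)) * exp (- C\<^sub>1)"
  define K where "K = mehler_const \<theta> (real CARD('n) / 2)"
  define M where "M = max 1 (K / c)"
  have \<theta>: "0 < \<theta>" "\<theta> < 1" using q by (auto simp: \<theta>_def)
  have k: "0 < k" using \<theta> by (simp add: k_def)
  have pi1: "pi powr (- (real CARD('n) / 2)) \<le> 1"
    using pi_gt3 powr_mono[of "- (real CARD('n) / 2)" 0 pi] by simp
  have "c \<le> 1 * 1" unfolding c_def using pi1 C\<^sub>1_nonneg by (intro mult_mono) auto
  then have c: "0 < c" "c \<le> 1" by (simp_all add: c_def)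
  have K: "0 \<le> K" unfolding K_def using \<theta> by (intro mehler_const_nonneg) auto
  have bound: "gauss_modular p (abs_riesz \<beta> G) \<le> ennreal (M powr P * exp C\<^sub>1) * heat_const k"
    if [measurable]: "G \<in> borel_measurable borel" and G: "gauss_modular p G \<le> 1" for G
  proof -
    define F where "F y = ennreal c * (ennreal (exp (- \<theta> * (norm y)\<^sup>2)) * G y)" for y
    have [measurable]: "F \<in> borel_measurable borel" unfolding F_def by measurable
    have "lebesgue_modular p F \<le> gauss_modular p G"
      unfolding lebesgue_modular_def gauss_modular_def
    proof (intro nn_integral_mono)
      fix y :: "real ^ 'n"
      have "F y = ennreal (c * exp (- \<theta> * (norm y)\<^sup>2)) * G y"
        using c by (simp add: F_def ennreal_mult mult.assoc)
      then have "ennpowr (F y) (p y) = ennreal ((c * exp (- \<theta> * (norm y)\<^sup>2)) powr p y) * ennpowr (G y) (p y)"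
        using c by (simp add: ennpowr_cmult)
      also have "\<dots> \<le> gauss_density y * ennpowr (G y) (p y)"
        unfolding gauss_density_def
      proof (intro mult_right_mono ennreal_leI)
        have "c powr p y \<le> c powr 1" using c p_ge_1 by (intro powr_mono') auto
        then have "c powr p y \<le> c" using c by simp
        then have "c powr p y * exp (- (norm y)\<^sup>2 / q) powr p y \<le> c * (exp C\<^sub>1 * exp (- (norm y)\<^sup>2))"
          using weight_compare(1)[OF q, of y] c by (intro mult_mono) auto
        also have "\<dots> = pi powr (- (real CARD('n) / 2)) * exp (- (norm y)\<^sup>2)"
          by (simp add: c_def exp_minus)
        finally show "(c * exp (- \<theta> * (norm y)\<^sup>2)) powr p y \<le> pi powr (- (real CARD('n) / 2)) * exp (- (norm y)\<^sup>2)"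
          by (simp add: powr_mult \<theta>_def)
      qed simp
      finally show "ennpowr (F y) (p y) \<le> ennpowr (G y) (p y) * gauss_density y"
        by (simp only: mult.commute)
    qed
    with G have "lebesgue_modular p F \<le> 1" by simp
    then have heat: "lebesgue_modular p (heat_average k (\<beta> / 2) F) \<le> heat_const k"
      using k \<beta> by (intro lebesgue_modular_heat_average) auto
    have "gauss_modular p (abs_riesz \<beta> G)
        \<le> (\<integral>\<^sup>+ x. ennreal (M powr P * exp C\<^sub>1) * ennpowr (heat_average k (\<beta> / 2) F x) (p x) \<partial>lborel)"
      unfolding gauss_modular_def
    proof (intro nn_integral_mono)
      fix x :: "real ^ 'n"
      define E where "E = exp (\<theta> * (norm x)\<^sup>2)"
      define S where "S = heat_average k (\<beta> / 2) F x"
      let ?F\<^sub>0 = "\<lambda>y. ennreal (exp (- \<theta> * (norm y)\<^sup>2)) * G y"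
      have M: "1 \<le> M" by (simp add: M_def)
      have E: "0 < E" by (simp add: E_def)
      have "S = ennreal c * heat_average k (\<beta> / 2) ?F\<^sub>0 x"
        unfolding S_def F_def using \<beta> by (intro heat_average_cmult) auto
      moreover have "ennreal (1 / c) * ennreal c = ennreal (1 / c * c)"
        using c by (intro ennreal_mult[symmetric]) auto
      ultimately have "ennreal (1 / c) * S = ennreal (1 / c * c) * heat_average k (\<beta> / 2) ?F\<^sub>0 x"
        by (simp only: mult.assoc[symmetric])
      then have S: "heat_average k (\<beta> / 2) ?F\<^sub>0 x = ennreal (1 / c) * S" using c by simp
      have "abs_riesz \<beta> G x \<le> ennreal K * (ennreal E * heat_average k (\<beta> / 2) ?F\<^sub>0 x)"
        unfolding K_def E_def by (intro abs_riesz_le_heat_average \<theta> \<beta> k_def) measurable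
      also have "\<dots> = ennreal (K * E * (1 / c)) * S"
        using K E c by (simp only: S ennreal_mult mult_nonneg_nonneg divide_nonneg_nonneg less_imp_le
            zero_le_one mult.assoc)
      also have "\<dots> \<le> ennreal (M * E) * S"
      proof (intro mult_right_mono ennreal_leI)
        have "K * E * (1 / c) = K / c * E" by simp
        also have "\<dots> \<le> M * E" using E by (intro mult_right_mono) (auto simp: M_def)
        finally show "K * E * (1 / c) \<le> M * E" .
      qed simp
      finally have "ennpowr (abs_riesz \<beta> G x) (p x) \<le> ennpowr (ennreal (M * E) * S) (p x)"
        using p_ge_1[of x] by (intro ennpowr_mono) auto
      also have "\<dots> = ennreal ((M * E) powr p x) * ennpowr S (p x)"
        using M E by (intro ennpowr_cmult) auto
      finally have "ennpowr (abs_riesz \<beta> G x) (p x) * gauss_density x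
          \<le> ennreal ((M * E) powr p x) * ennpowr S (p x) * gauss_density x"
        by (rule mult_right_mono) simp
      also have "\<dots> = ennreal ((M * E) powr p x * (pi powr (- (real CARD('n) / 2)) * exp (- (norm x)\<^sup>2))) * ennpowr S (p x)"
        by (subst ennreal_mult) (simp_all add: gauss_density_def mult_ac)
      also have "\<dots> \<le> ennreal (M powr P * exp C\<^sub>1) * ennpowr S (p x)"
      proof (intro mult_right_mono ennreal_leI)
        have "(M * E) powr p x * (pi powr (- (real CARD('n) / 2)) * exp (- (norm x)\<^sup>2))
            = M powr p x * (E powr p x * exp (- (norm x)\<^sup>2)) * pi powr (- (real CARD('n) / 2))"
          by (simp add: powr_mult mult_ac)
        also have "\<dots> \<le> M powr P * exp C\<^sub>1 * 1"
          using M pi1 p_le[of x] weight_compare(2)[OF q, of x]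
          by (intro mult_mono powr_mono) (auto simp: E_def \<theta>_def)
        finally show "(M * E) powr p x * (pi powr (- (real CARD('n) / 2)) * exp (- (norm x)\<^sup>2)) \<le> M powr P * exp C\<^sub>1"
          by simp
      qed simp
      finally show "ennpowr (abs_riesz \<beta> G x) (p x) * gauss_density x
          \<le> ennreal (M powr P * exp C\<^sub>1) * ennpowr (heat_average k (\<beta> / 2) F x) (p x)"
        by (simp add: S_def)
    qed
    also have "\<dots> = ennreal (M powr P * exp C\<^sub>1) * lebesgue_modular p (heat_average k (\<beta> / 2) F)"
      unfolding lebesgue_modular_def using \<beta> by (intro nn_integral_cmult) measurable
    also have "\<dots> \<le> ennreal (M powr P * exp C\<^sub>1) * heat_const k"
      by (intro mult_left_mono heat) simp
    finally show ?thesis .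
  qed
  have "ennreal (M powr P * exp C\<^sub>1) * heat_const k < top"
    using heat_const_finite by (simp add: ennreal_mult_less_top)
  then obtain C where "ennreal (M powr P * exp C\<^sub>1) * heat_const k = ennreal C"
    by (cases "ennreal (M powr P * exp C\<^sub>1) * heat_const k") auto
  with bound show ?thesis by metis
qed

section \<open>Exponents on Gaussian space\<close>

text \<open>The local condition makes \<open>p\<close> continuous, hence Borel, and also bounded, because its right-hand side never
exceeds \<open>C\<^sub>0\<close>. If \<open>q\<close> were 1, then \<open>p\<close> would be close to 1 outside a large ball, which is not a
null set, contradicting \<open>1 < p_minus p\<close>.\<close>

lemma log_hoelder_exponent_of_gaussian:
  fixes p :: "real ^ 'n::finite \<Rightarrow> ereal"
  assumes p: "p \<in> P_gauss_inf \<inter> LH0" and "1 < p_minus p"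
  obtains P q C\<^sub>0 C\<^sub>1 where "log_hoelder_exponent (\<lambda>x. real_of_ereal (p x)) P q C\<^sub>0 C\<^sub>1" "1 < q"
proof -
  define r where "r x = real_of_ereal (p x)" for x
  have "\<And>x. \<bar>p x\<bar> \<noteq> \<infinity>" using p by (auto simp: LH0_def)
  then have pr: "p x = ereal (r x)" for x by (simp add: r_def ereal_real)
  obtain C\<^sub>0 where C\<^sub>0: "0 < C\<^sub>0"
    and lh: "\<And>x y. x \<noteq> y \<Longrightarrow> \<bar>r x - r y\<bar> \<le> C\<^sub>0 / ln (exp 1 + 1 / norm (x - y))"
    using p unfolding LH0_def r_def by auto
  obtain C\<^sub>1 q where C\<^sub>1: "0 < C\<^sub>1" and q1: "1 \<le> q" and "\<And>x. x \<noteq> 0 \<Longrightarrow> \<bar>p x - ereal q\<bar> \<le> ereal (C\<^sub>1 / (norm x)\<^sup>2)"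
    using p unfolding P_gauss_inf_def by auto
  then have dec: "x \<noteq> 0 \<Longrightarrow> \<bar>r x - q\<bar> \<le> C\<^sub>1 / (norm x)\<^sup>2" for x by (simp add: pr)
  have ge1: "1 \<le> r x" for x
    using p unfolding P_gauss_inf_def exponent_function_def by (simp add: pr one_ereal_def)
  have L: "1 \<le> ln (exp 1 + 1 / norm (x - y))" for x y :: "real ^ 'n"
    by (subst ln_ge_iff) (auto intro: add_pos_nonneg)
  have "continuous_on UNIV r"
    unfolding continuous_on_iff
  proof (intro ballI allI impI)
    fix x :: "real ^ 'n" and e :: real assume e: "0 < e"
    show "\<exists>d>0. \<forall>y\<in>UNIV. dist y x < d \<longrightarrow> dist (r y) (r x) < e"
    proof (intro exI[of _ "exp (- (C\<^sub>0 / e))"] conjI ballI impI)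
      fix y assume y: "dist y x < exp (- (C\<^sub>0 / e))"
      show "dist (r y) (r x) < e"
      proof (cases "y = x")
        case False
        then have n: "0 < norm (y - x)" by simp
        have "exp (C\<^sub>0 / e) < 1 / norm (y - x)"
          using y n by (simp add: dist_norm exp_minus field_simps)
        then have "exp (C\<^sub>0 / e) < exp 1 + 1 / norm (y - x)" by (simp add: add_strict_increasing)
        then have "ln (exp (C\<^sub>0 / e)) < ln (exp 1 + 1 / norm (y - x))"
          by (intro ln_less_cancel_iff[THEN iffD2]) (auto intro: add_pos_nonneg)
        then have "C\<^sub>0 / ln (exp 1 + 1 / norm (y - x)) < e"
          using L[of y x] e by (simp add: field_simps)
        then show ?thesis using lh[OF False] by (simp add: dist_real_def)
      qed (use e in simp)
    qed simp
  qed
  then have meas: "r \<in> borel_measurable borel" by (rule borel_measurable_continuous_onI)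
  have le: "r x \<le> r 0 + C\<^sub>0" for x
  proof (cases "x = 0")
    case False
    have "C\<^sub>0 / ln (exp 1 + 1 / norm (x - 0)) \<le> C\<^sub>0 / 1"
      using C\<^sub>0 L[of x 0] by (intro divide_left_mono) auto
    then show ?thesis using lh[OF False] by simp
  qed (use C\<^sub>0 in simp)
  have "q \<noteq> 1"
  proof
    assume "q = 1"
    obtain s where s: "1 < ereal s" "ereal s < p_minus p" using ereal_dense2[OF assms(2)] by auto
    have "AE x in lebesgue. - p x \<le> esssup lebesgue (\<lambda>x. - p x)" by (rule esssup_AE)
    then have ae: "AE x in lebesgue. s < r x"
    proof eventually_elim
      case (elim x)
      then have "p_minus p \<le> p x" unfolding p_minus_def by (subst ereal_uminus_le_reorder)
      with s(2) have "ereal s < p x" by (rule less_le_trans)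
      then show ?case by (simp add: pr)
    qed
    define R where "R = sqrt (C\<^sub>1 / (s - 1))"
    have s1: "1 < s" using s(1) by (simp add: one_ereal_def)
    have "AE x in lebesgue. x \<notin> {x :: real ^ 'n. R < norm x}"
      using ae
    proof eventually_elim
      case (elim x)
      show ?case
      proof
        assume "x \<in> {x. R < norm x}"
        moreover have R0: "0 < R" using C\<^sub>1 s1 by (simp add: R_def)
        ultimately have x: "x \<noteq> 0" "R\<^sup>2 < (norm x)\<^sup>2" by (auto intro!: power_strict_mono)
        then have "C\<^sub>1 / (s - 1) < (norm x)\<^sup>2" using C\<^sub>1 s1 by (simp add: R_def)
        then have "C\<^sub>1 / (norm x)\<^sup>2 < s - 1" using s1 x by (simp add: field_simps)
        then show False using dec[OF x(1)] elim \<open>q = 1\<close> by simp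
      qed
    qed
    moreover have op: "open {x :: real ^ 'n. R < norm x}"
      by (intro open_Collect_less continuous_intros)
    moreover have "{x :: real ^ 'n. R < norm x} \<in> sets lebesgue"
      using borel_open[OF op] by simp
    ultimately have "{x :: real ^ 'n. R < norm x} \<in> null_sets lebesgue"
      by (simp only: AE_iff_null_sets)
    moreover obtain v :: "real ^ 'n" where "norm v = \<bar>R\<bar> + 1"
      using vector_choose_size[of "\<bar>R\<bar> + 1"] by auto
    then have "{x :: real ^ 'n. R < norm x} \<noteq> {}"
      by (intro ex_in_conv[THEN iffD1] exI[of _ v]) simp
    ultimately show False
      using open_not_negligible[OF op] unfolding negligible_iff_null_sets by blast
  qed
  then have q: "1 < q" using q1 by simp
  have "log_hoelder_exponent r (r 0 + C\<^sub>0) q C\<^sub>0 C\<^sub>1"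
  proof
    show "r \<in> borel_measurable borel" by (rule meas)
    show "1 \<le> r x" "r x \<le> r 0 + C\<^sub>0" for x by (rule ge1, rule le)
    show "\<bar>r x - r y\<bar> \<le> C\<^sub>0 / ln (exp 1 + 1 / norm (x - y))" if "x \<noteq> y" for x y by (rule lh[OF that])
    show "\<bar>r x - q\<bar> * (norm x)\<^sup>2 \<le> C\<^sub>1" for x
    proof (cases "x = 0")
      case False
      then show ?thesis using dec[OF False] by (simp add: field_simps)
    qed (use C\<^sub>1 in simp)
    show "0 \<le> C\<^sub>0" "1 \<le> q" using C\<^sub>0 q by simp_all
  qed
  then show ?thesis using that q unfolding r_def by blast
qed

section \<open>Modulars and norms\<close>

lemma gaussian_measure_eq: "gaussian_measure = density lebesgue gauss_density"
  unfolding gaussian_measure_def gauss_density_def[abs_def] ..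

lemma measurable_gauss_density_lebesgue [measurable]: "gauss_density \<in> borel_measurable lebesgue"
  by (rule measurable_completion) measurable

lemma sets_gaussian_measure [measurable_cong]: "sets gaussian_measure = sets lebesgue"
  by (simp add: gaussian_measure_def)

lemma measurable_abs_powr [measurable]:
  assumes [measurable]: "f \<in> borel_measurable M" "g \<in> borel_measurable M"
  shows "(\<lambda>x. abs_powr (f x) (g x)) \<in> borel_measurable M"
  unfolding abs_powr_def by measurable

lemma modular_eq_lebesgue:
  assumes [measurable]: "p \<in> borel_measurable lebesgue" "f \<in> borel_measurable lebesgue"
  shows "modular p f = (\<integral>\<^sup>+ x. abs_powr (f x) (real_of_ereal (p x)) * gauss_density x \<partial>lebesgue)"
  unfolding modular_def gaussian_measure_eq
  by (subst nn_integral_density) (auto simp: mult.commute)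

text \<open>Exponents are at least 1, so dividing the function by \<open>C\<close> divides the modular by at least \<open>C\<close>. This turns
modular bounds by a constant into norm bounds.\<close>

lemma modular_div_le:
  assumes [measurable]: "p \<in> borel_measurable lebesgue" "f \<in> borel_measurable lebesgue"
    and p: "\<And>x. 1 \<le> real_of_ereal (p x)" and C: "1 \<le> C" and l: "0 < l"
  shows "modular p (\<lambda>x. f x / ereal (C * l)) \<le> ennreal (1 / C) * modular p (\<lambda>x. f x / ereal l)"
proof -
  have "abs_powr (a / ereal (C * l)) r \<le> ennreal (1 / C) * abs_powr (a / ereal l) r" if "1 \<le> r" for a r
  proof (cases a)
    case (real u)
    have "(1 / C) powr r \<le> (1 / C) powr 1" using that C by (intro powr_mono') auto
    then have "(1 / C) powr r * (\<bar>u\<bar> / l) powr r \<le> 1 / C * (\<bar>u\<bar> / l) powr r"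
      using C by (intro mult_right_mono) auto
    then have "(1 / C * (\<bar>u\<bar> / l)) powr r \<le> 1 / C * (\<bar>u\<bar> / l) powr r"
      by (simp only: powr_mult)
    then have "ennreal ((1 / C * (\<bar>u\<bar> / l)) powr r) \<le> ennreal (1 / C) * ennreal ((\<bar>u\<bar> / l) powr r)"
      using C by (subst ennreal_mult[symmetric]) (auto intro: ennreal_leI)
    moreover have "\<bar>u / (C * l)\<bar> = 1 / C * (\<bar>u\<bar> / l)" "\<bar>u / l\<bar> = \<bar>u\<bar> / l"
      using C l by (simp_all add: abs_mult)
    ultimately show ?thesis
      using C l real by (simp add: abs_powr_def)
  qed (use C l in \<open>simp_all add: abs_powr_def ennreal_mult_top\<close>)
  then have "modular p (\<lambda>x. f x / ereal (C * l))
      \<le> (\<integral>\<^sup>+ x. ennreal (1 / C) * abs_powr (f x / ereal l) (real_of_ereal (p x)) \<partial>\<gamma>)"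
    unfolding modular_def using p by (intro nn_integral_mono) auto
  also have "\<dots> = ennreal (1 / C) * modular p (\<lambda>x. f x / ereal l)"
    unfolding modular_def by (intro nn_integral_cmult) measurable
  finally show ?thesis .
qed

text \<open>\<open>f\<close> is replaced by a Borel function \<open>g\<close> that agrees with it almost everywhere, since Tonelli and joint
measurability are used for Borel functions. Finiteness of the modular of the absolute potential forces it to
be finite almost everywhere, and this is the existence of the integral.\<close>

lemma riesz_modular_bound:
  fixes p :: "real ^ 'n::finite \<Rightarrow> ereal"
  defines "r \<equiv> \<lambda>x. real_of_ereal (p x)"
  assumes p [measurable]: "p \<in> borel_measurable lebesgue" and r [measurable]: "r \<in> borel_measurable borel"
    and f [measurable]: "f \<in> borel_measurable lebesgue" and l: "0 < l"
    and r1: "\<And>x. 1 \<le> r x"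
    and mod: "modular p (\<lambda>x. f x / ereal l) \<le> 1"
    and bound: "\<And>G. G \<in> borel_measurable borel \<Longrightarrow> gauss_modular r G \<le> 1 \<Longrightarrow>
      gauss_modular r (abs_riesz \<beta> G) \<le> ennreal C"
  shows "riesz_potential \<beta> f \<in> borel_measurable lebesgue"
    and "modular p (\<lambda>x. riesz_potential \<beta> f x / ereal l) \<le> ennreal C"
    and "AE x in lebesgue. riesz_defined \<beta> f x"
proof -
  have "(\<lambda>x. real_of_ereal (f x)) \<in> borel_measurable lebesgue" by measurable
  from completion_ex_borel_measurable_real[OF this]
  obtain g where g [measurable]: "g \<in> borel_measurable borel" and fg: "AE x in lborel. real_of_ereal (f x) = g x"
    by auto
  have [measurable]: "g \<in> borel_measurable lebesgue" by (rule measurable_completion) measurable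
  have fg': "AE x in lebesgue. real_of_ereal (f x) = g x" using fg by (rule AE_completion)
  have kernel [measurable]: "(\<lambda>(x, y). riesz_kernel \<beta> x (y :: real ^ 'n)) \<in> borel_measurable (borel \<Otimes>\<^sub>M borel)"
    using measurable_riesz_kernel by (simp add: case_prod_beta')
  have kx [measurable]: "riesz_kernel \<beta> x \<in> borel_measurable borel" for x :: "real ^ 'n"
    using measurable_Pair2[OF kernel, of x] by simp
  have kx' [measurable]: "riesz_kernel \<beta> x \<in> borel_measurable lebesgue" for x :: "real ^ 'n"
    by (rule measurable_completion) measurable
  have pot: "riesz_potential \<beta> f x = ereal (LINT y|lborel. riesz_kernel \<beta> x y * g y)" for x
  proof -
    have "(LINT y|lebesgue. riesz_kernel \<beta> x y * real_of_ereal (f y)) = (LINT y|lebesgue. riesz_kernel \<beta> x y * g y)"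
    proof (rule integral_cong_AE)
      show "AE y in lebesgue. riesz_kernel \<beta> x y * real_of_ereal (f y) = riesz_kernel \<beta> x y * g y"
        using fg' by eventually_elim simp
    qed measurable
    also have "\<dots> = (LINT y|lborel. riesz_kernel \<beta> x y * g y)" by (rule integral_completion) measurable
    finally show ?thesis by (simp add: riesz_potential_def)
  qed
  have "(\<lambda>x. LINT y|lborel. riesz_kernel \<beta> x y * g y) \<in> borel_measurable borel" by measurable
  then have "(\<lambda>x. LINT y|lborel. riesz_kernel \<beta> x y * g y) \<in> borel_measurable lebesgue"
    by (intro measurable_completion) simp
  then show meas [measurable]: "riesz_potential \<beta> f \<in> borel_measurable lebesgue"
    unfolding pot[abs_def] by measurable
  define G where "G y = ennreal (\<bar>g y\<bar> / l)" for y
  have [measurable]: "G \<in> borel_measurable borel" unfolding G_def by measurable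
  have "gauss_modular r G = (\<integral>\<^sup>+ x. ennpowr (ennreal (\<bar>real_of_ereal (f x)\<bar> / l)) (r x) * gauss_density x \<partial>lborel)"
    unfolding gauss_modular_def G_def
  proof (rule nn_integral_cong_AE)
    show "AE x in lborel. ennpowr (ennreal (\<bar>g x\<bar> / l)) (r x) * gauss_density x
        = ennpowr (ennreal (\<bar>real_of_ereal (f x)\<bar> / l)) (r x) * gauss_density x"
      using fg by eventually_elim (simp only:)
  qed
  also have "\<dots> = (\<integral>\<^sup>+ x. ennpowr (ennreal (\<bar>real_of_ereal (f x)\<bar> / l)) (r x) * gauss_density x \<partial>lebesgue)"
    by (rule nn_integral_completion[symmetric])
  also have "\<dots> \<le> (\<integral>\<^sup>+ x. abs_powr (f x / ereal l) (r x) * gauss_density x \<partial>lebesgue)"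
  proof (intro nn_integral_mono mult_right_mono)
    fix x
    show "ennpowr (ennreal (\<bar>real_of_ereal (f x)\<bar> / l)) (r x) \<le> abs_powr (f x / ereal l) (r x)"
      using l by (cases "f x") (simp_all add: abs_powr_def)
  qed simp
  also have "\<dots> = modular p (\<lambda>x. f x / ereal l)"
    unfolding r_def by (intro modular_eq_lebesgue[symmetric]) measurable
  finally have "gauss_modular r G \<le> 1" using mod by simp
  then have riesz: "gauss_modular r (abs_riesz \<beta> G) \<le> ennreal C" by (intro bound) measurable
  have abs_riesz_G: "(\<integral>\<^sup>+ y. ennreal \<bar>riesz_kernel \<beta> x y * g y\<bar> \<partial>lborel) = ennreal l * abs_riesz \<beta> G x" for x
  proof -
    have "ennreal \<bar>riesz_kernel \<beta> x y * g y\<bar> = ennreal l * (ennreal \<bar>riesz_kernel \<beta> x y\<bar> * G y)" for y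
    proof -
      have "\<bar>riesz_kernel \<beta> x y * g y\<bar> = l * (\<bar>riesz_kernel \<beta> x y\<bar> * (\<bar>g y\<bar> / l))"
        using l by (simp add: abs_mult)
      also have "ennreal \<dots> = ennreal l * (ennreal \<bar>riesz_kernel \<beta> x y\<bar> * ennreal (\<bar>g y\<bar> / l))"
        using l by (simp only: ennreal_mult mult_nonneg_nonneg divide_nonneg_nonneg abs_ge_zero less_imp_le)
      finally show ?thesis by (simp add: G_def)
    qed
    then show ?thesis unfolding abs_riesz_def by (simp add: nn_integral_cmult)
  qed
  have pot_le: "ennreal (\<bar>real_of_ereal (riesz_potential \<beta> f x)\<bar> / l) \<le> abs_riesz \<beta> G x" for x
  proof -
    have "ennreal \<bar>LINT y|lborel. riesz_kernel \<beta> x y * g y\<bar> \<le> ennreal l * abs_riesz \<beta> G x"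
      unfolding abs_riesz_G[symmetric] by (rule ennreal_abs_integral_le)
    then have "ennreal (1 / l) * ennreal \<bar>LINT y|lborel. riesz_kernel \<beta> x y * g y\<bar>
        \<le> ennreal (1 / l) * (ennreal l * abs_riesz \<beta> G x)"
      by (rule mult_left_mono) simp
    also have "\<dots> = ennreal (1 / l * l) * abs_riesz \<beta> G x"
      using l by (subst ennreal_mult) (auto simp: mult.assoc)
    also have "\<dots> = abs_riesz \<beta> G x" using l by simp
    also have "ennreal (1 / l) * ennreal \<bar>LINT y|lborel. riesz_kernel \<beta> x y * g y\<bar>
        = ennreal (1 / l * \<bar>LINT y|lborel. riesz_kernel \<beta> x y * g y\<bar>)"
      using l by (intro ennreal_mult[symmetric]) auto
    finally show ?thesis by (simp add: pot)
  qed
  have "modular p (\<lambda>x. riesz_potential \<beta> f x / ereal l)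
      = (\<integral>\<^sup>+ x. abs_powr (riesz_potential \<beta> f x / ereal l) (r x) * gauss_density x \<partial>lebesgue)"
    unfolding r_def by (intro modular_eq_lebesgue) measurable
  also have "\<dots> \<le> (\<integral>\<^sup>+ x. ennpowr (abs_riesz \<beta> G x) (r x) * gauss_density x \<partial>lebesgue)"
  proof (intro nn_integral_mono mult_right_mono)
    fix x
    have "abs_powr (riesz_potential \<beta> f x / ereal l) (r x)
        = ennpowr (ennreal (\<bar>real_of_ereal (riesz_potential \<beta> f x)\<bar> / l)) (r x)"
      using l by (simp add: pot abs_powr_def)
    also have "\<dots> \<le> ennpowr (abs_riesz \<beta> G x) (r x)"
      using r1[of x] by (intro ennpowr_mono pot_le) simp
    finally show "abs_powr (riesz_potential \<beta> f x / ereal l) (r x) \<le> ennpowr (abs_riesz \<beta> G x) (r x)" .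
  qed simp
  also have "\<dots> = gauss_modular r (abs_riesz \<beta> G)"
    unfolding gauss_modular_def by (rule nn_integral_completion)
  finally show "modular p (\<lambda>x. riesz_potential \<beta> f x / ereal l) \<le> ennreal C" using riesz by simp
  have "(\<integral>\<^sup>+ x. ennpowr (abs_riesz \<beta> G x) (r x) * gauss_density x \<partial>lborel) \<noteq> \<infinity>"
    using riesz unfolding gauss_modular_def by (auto simp: top_unique)
  then have "AE x in lborel. ennpowr (abs_riesz \<beta> G x) (r x) * gauss_density x \<noteq> \<infinity>"
    by (intro nn_integral_PInf_AE) measurable
  then have "AE x in lebesgue. ennpowr (abs_riesz \<beta> G x) (r x) * gauss_density x \<noteq> \<infinity>"
    by (rule AE_completion)
  then show "AE x in lebesgue. riesz_defined \<beta> f x"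
  proof eventually_elim
    case (elim x)
    have "gauss_density x \<noteq> 0" by (simp add: gauss_density_def)
    with elim have fin: "abs_riesz \<beta> G x \<noteq> top"
      by (auto simp: ennreal_top_mult)
    have "(\<integral>\<^sup>+ y. ennreal \<bar>riesz_kernel \<beta> x y * real_of_ereal (f y)\<bar> \<partial>lebesgue)
        = (\<integral>\<^sup>+ y. ennreal \<bar>riesz_kernel \<beta> x y * g y\<bar> \<partial>lebesgue)"
    proof (rule nn_integral_cong_AE)
      show "AE y in lebesgue. ennreal \<bar>riesz_kernel \<beta> x y * real_of_ereal (f y)\<bar>
          = ennreal \<bar>riesz_kernel \<beta> x y * g y\<bar>"
        using fg' by eventually_elim (simp only:)
    qed
    also have "\<dots> = ennreal l * abs_riesz \<beta> G x"
      by (simp only: nn_integral_completion abs_riesz_G)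
    also have "\<dots> < \<infinity>" using fin by (simp add: ennreal_mult_less_top top.not_eq_extremum)
    finally show ?case
      unfolding riesz_defined_def by (intro integrableI_bounded) auto
  qed
qed

theorem theorem1p2:
  fixes p :: "real ^ 'n::finite \<Rightarrow> ereal" and \<beta> :: real
  assumes "p \<in> P_gauss_inf \<inter> LH0"
    and "1 < p_minus p" and "p_minus p \<le> p_plus p" and "p_plus p < \<infinity>"
    and "\<beta> \<ge> 1"
  shows "\<exists>C::real. C > 0 \<and> (\<forall>f \<in> Lp_gauss p.
    (AE x in lebesgue. riesz_defined \<beta> f x) \<and>
    riesz_potential \<beta> f \<in> Lp_gauss p \<and>
    Lp_norm p (riesz_potential \<beta> f) \<le> ennreal C * Lp_norm p f)"
proof -
  define r where "r = (\<lambda>x. real_of_ereal (p x))"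
  obtain P q C\<^sub>0 C\<^sub>1 where "log_hoelder_exponent r P q C\<^sub>0 C\<^sub>1" and q: "1 < q"
    using log_hoelder_exponent_of_gaussian[OF assms(1,2)] unfolding r_def by blast
  then interpret log_hoelder_exponent r P q C\<^sub>0 C\<^sub>1 by simp
  have p [measurable]: "p \<in> borel_measurable lebesgue"
    using assms(1) by (simp add: P_gauss_inf_def exponent_function_def)
  have "0 < \<beta>" using assms(5) by simp
  then obtain K :: real where K: "\<forall>G \<in> borel_measurable borel.
      gauss_modular r G \<le> 1 \<longrightarrow> gauss_modular r (abs_riesz \<beta> G) \<le> ennreal K"
    using gauss_modular_abs_riesz_bounded[OF log_hoelder_exponent_axioms q] by blast
  define C where "C = max 1 K"
  have C: "1 \<le> C" by (simp add: C_def)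
  have r1: "1 \<le> real_of_ereal (p x)" for x using p_ge_1[of x] by (simp add: r_def)
  note bound = riesz_modular_bound[OF p measurable_p[unfolded r_def] _ _ r1 _ K[unfolded r_def, rule_format]]
  have step: "(AE x in lebesgue. riesz_defined \<beta> f x) \<and> riesz_potential \<beta> f \<in> borel_measurable lebesgue
      \<and> modular p (\<lambda>x. riesz_potential \<beta> f x / ereal (C * l)) \<le> 1"
    if f: "f \<in> borel_measurable lebesgue" and l: "0 < l" and mod: "modular p (\<lambda>x. f x / ereal l) \<le> 1" for f l
  proof -
    note b = bound[OF f l mod]
    have "modular p (\<lambda>x. riesz_potential \<beta> f x / ereal (C * l))
        \<le> ennreal (1 / C) * modular p (\<lambda>x. riesz_potential \<beta> f x / ereal l)"
      by (intro modular_div_le p b(1) r1 C l)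
    also have "\<dots> \<le> ennreal (1 / C) * ennreal C"
      by (intro mult_left_mono order_trans[OF b(2)] ennreal_leI) (simp_all add: C_def)
    also have "\<dots> = 1" using C by (subst ennreal_mult[symmetric]) auto
    finally show ?thesis using b by simp
  qed
  have "(AE x in lebesgue. riesz_defined \<beta> f x) \<and> riesz_potential \<beta> f \<in> Lp_gauss p \<and>
      Lp_norm p (riesz_potential \<beta> f) \<le> ennreal C * Lp_norm p f" if "f \<in> Lp_gauss p" for f
  proof -
    from that obtain l\<^sub>0 where f: "f \<in> borel_measurable lebesgue" and l\<^sub>0: "0 < l\<^sub>0"
      and fin: "modular p (\<lambda>x. f x / ereal l\<^sub>0) < \<infinity>"
      by (auto simp: Lp_gauss_def)
    then obtain m where m: "modular p (\<lambda>x. f x / ereal l\<^sub>0) = ennreal m" "0 \<le> m"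
      by (cases "modular p (\<lambda>x. f x / ereal l\<^sub>0)") auto
    define l\<^sub>1 where "l\<^sub>1 = max 1 m * l\<^sub>0"
    have l\<^sub>1: "0 < l\<^sub>1" using l\<^sub>0 by (simp add: l\<^sub>1_def)
    have "modular p (\<lambda>x. f x / ereal l\<^sub>1) \<le> ennreal (1 / max 1 m) * modular p (\<lambda>x. f x / ereal l\<^sub>0)"
      unfolding l\<^sub>1_def by (intro modular_div_le p f r1 l\<^sub>0) simp
    also have "\<dots> = ennreal (1 / max 1 m * m)" unfolding m(1) using m(2) by (intro ennreal_mult[symmetric]) auto
    also have "\<dots> \<le> ennreal 1" by (intro ennreal_leI) (simp add: divide_le_eq)
    finally have l\<^sub>1_mod: "modular p (\<lambda>x. f x / ereal l\<^sub>1) \<le> 1" by simp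
    note s\<^sub>1 = step[OF f l\<^sub>1 l\<^sub>1_mod]
    have "modular p (\<lambda>x. riesz_potential \<beta> f x / ereal (C * l\<^sub>1)) < \<infinity>"
    proof (rule le_less_trans)
      show "modular p (\<lambda>x. riesz_potential \<beta> f x / ereal (C * l\<^sub>1)) \<le> 1" using s\<^sub>1 by simp
    qed simp
    then have "riesz_potential \<beta> f \<in> Lp_gauss p"
      unfolding Lp_gauss_def using s\<^sub>1 C l\<^sub>1 by (intro CollectI conjI exI[of _ "C * l\<^sub>1"]) simp_all
    moreover have "Lp_norm p (riesz_potential \<beta> f) \<le> ennreal C * Lp_norm p f"
    proof -
      have "ennreal (1 / C) * Lp_norm p (riesz_potential \<beta> f) \<le> Lp_norm p f"
        unfolding Lp_norm_def[of p f]
      proof (rule Inf_greatest)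
        fix z assume "z \<in> {ennreal l | l. 0 < l \<and> modular p (\<lambda>x. f x / ereal l) \<le> 1}"
        then obtain l where z: "z = ennreal l" and l: "0 < l" "modular p (\<lambda>x. f x / ereal l) \<le> 1" by auto
        have "Lp_norm p (riesz_potential \<beta> f) \<le> ennreal (C * l)"
          unfolding Lp_norm_def using step[OF f l] C l(1) by (intro Inf_lower) auto
        then have "ennreal (1 / C) * Lp_norm p (riesz_potential \<beta> f) \<le> ennreal (1 / C) * ennreal (C * l)"
          by (rule mult_left_mono) simp
        also have "\<dots> = z" using C l by (subst ennreal_mult[symmetric]) (auto simp: z)
        finally show "ennreal (1 / C) * Lp_norm p (riesz_potential \<beta> f) \<le> z" .
      qed
      then have "ennreal C * (ennreal (1 / C) * Lp_norm p (riesz_potential \<beta> f)) \<le> ennreal C * Lp_norm p f"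
        by (rule mult_left_mono) simp
      moreover have "ennreal C * ennreal (1 / C) = 1"
        using C by (subst ennreal_mult[symmetric]) auto
      ultimately show ?thesis by (simp only: mult.assoc[symmetric] mult_1)
    qed
    ultimately show ?thesis using s\<^sub>1 by simp
  qed
  with C show ?thesis by (intro exI[of _ C]) auto
qed

end
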